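(* Let $M_1^m,M_2^m$ be compact connected Riemannian manifolds (possibly with boundary) that have Riemannian isometric embeddings $\varphi_i:M_i^m\to N^{m+1}$ ($i=1,2$) into a connected Riemannian manifold $N$, with embedding constants $$C_{M_i}=\sup_{p,q\in M_i}\big(d_{M_i}(p,q)-d_N(\varphi_i(p),\varphi_i(q))\big),$$ and suppose that their images are disjoint and lie in the boundary of a region $B_0\subset N$. Then $$d_{GH}(M_1,M_2)\le S_{M_1}+S_{M_2}+d_H^N\big(\varphi_1(M_1),\varphi_2(M_2)\big),$$ where $S_{M_i}=\sqrt{C_{M_i}(\operatorname{diam}(M_i)+C_{M_i})}$.
   Context: A Riemannian isometric embedding $\varphi:M\to N$ is a diffeomorphism onto its image with $|\varphi_*V|=|V|$ for all tangent vectors $V$ of $M$. $d_{M_i},d_N$ are Riemannian distances. $d_H^Z(X_1,X_2)=\inf\{\rho>0: X_1\subset T_\rho(X_2),\ X_2\subset T_\rho(X_1)\}$ is the Hausdorff distance in a metric space $Z$, where $T_\rho(X)$ is the tubular neighborhood of radius $\rho$ of $X$. The Gromov–Hausdorff distance is $d_{GH}(M_1,M_2)=\inf d_H^Z(\psi_1(M_1),\psi_2(M_2))$ over all metric spaces $Z$ and all distance-preserving maps $\psi_i:M_i\to Z$. *)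

theory Defs
  imports "HOL-Analysis.Analysis"
begin

section \<open>Smooth maps between subsets of Euclidean spaces\<close>

fun times_differentiable_on ::
  "nat \<Rightarrow> ('a::euclidean_space \<Rightarrow> 'b::euclidean_space) \<Rightarrow> 'a set \<Rightarrow> bool" where
  "times_differentiable_on 0 f S \<longleftrightarrow> continuous_on S f"
| "times_differentiable_on (Suc k) f S \<longleftrightarrow>
     (\<forall>x\<in>S. f differentiable (at x)) \<and>
     (\<forall>v. times_differentiable_on k (\<lambda>x. frechet_derivative f (at x) v) S)"

text \<open>A map on an arbitrary subset is smooth if locally it extends to a \<open>C\<^sup>\<infinity>\<close> map on an open set.\<close>

definition smooth_on ::
  "'a::euclidean_space set \<Rightarrow> ('a \<Rightarrow> 'b::euclidean_space) \<Rightarrow> bool" where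
  "smooth_on A f \<longleftrightarrow>
     (\<forall>x\<in>A. \<exists>U F. open U \<and> x \<in> U \<and> (\<forall>k. times_differentiable_on k F U) \<and>
        (\<forall>y\<in>A \<inter> U. F y = f y))"

section \<open>Riemannian manifolds with (possibly empty) boundary\<close>

text \<open>A chart is a pair \<open>(U, x)\<close> of a domain and a coordinate map; only the values of \<open>x\<close> on \<open>U\<close>
  matter. The dimension of the manifold is \<open>DIM('e)\<close>, so it is at least one. A tangent vector at \<open>p\<close>
  is represented by its component vector in \<open>'e\<close> with respect to a chart around \<open>p\<close>; accordingly
  \<open>metric_tensor M c p v w\<close> is the inner product of the tangent vectors at \<open>p\<close> that have components
  \<open>v\<close> and \<open>w\<close> in the chart \<open>c\<close>.\<close>

type_synonym ('a, 'e) chart = "'a set \<times> ('a \<Rightarrow> 'e)"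

record ('a, 'e) riem =
  mfd_topology :: "'a topology"
  atlas :: "('a, 'e) chart set"
  metric_tensor :: "('a, 'e) chart \<Rightarrow> 'a \<Rightarrow> 'e \<Rightarrow> 'e \<Rightarrow> real"

abbreviation pts :: "('a, 'e) riem \<Rightarrow> 'a set" where
  "pts M \<equiv> topspace (mfd_topology M)"

abbreviation chart_inv :: "('a, 'e) chart \<Rightarrow> 'e \<Rightarrow> 'a" where
  "chart_inv c \<equiv> inv_into (fst c) (snd c)"

definition boundary_normal :: "'e::euclidean_space" where
  "boundary_normal = (SOME b. b \<in> Basis)"

definition half_space :: "'e::euclidean_space set" where
  "half_space = {x. 0 \<le> x \<bullet> boundary_normal}"

definition is_chart :: "'a topology \<Rightarrow> ('a, 'e::euclidean_space) chart \<Rightarrow> bool" where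
  "is_chart X c \<longleftrightarrow>
     openin X (fst c) \<and>
     openin (top_of_set half_space) (snd c ` fst c) \<and>
     homeomorphic_map (subtopology X (fst c)) (top_of_set (snd c ` fst c)) (snd c)"

definition inner_product :: "('e::euclidean_space \<Rightarrow> 'e \<Rightarrow> real) \<Rightarrow> bool" where
  "inner_product g \<longleftrightarrow>
     bilinear g \<and> (\<forall>v w. g v w = g w v) \<and> (\<forall>v. v \<noteq> 0 \<longrightarrow> 0 < g v v)"

text \<open>The differential at \<open>p\<close> of a map \<open>f\<close> with respect to a chart \<open>c\<close> around \<open>p\<close> and a chart \<open>d\<close>
  around \<open>f p\<close>. The derivative is taken within the coordinate domain, which is relatively open in
  the half space; hence it is unique also at boundary points.\<close>

definition coord_differential ::
  "('a, 'e::euclidean_space) chart \<Rightarrow> ('b, 'f::euclidean_space) chart \<Rightarrow> ('a \<Rightarrow> 'b) \<Rightarrow> 'a \<Rightarrow> 'e \<Rightarrow> 'f"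
  where
  "coord_differential c d f p =
     frechet_derivative (snd d \<circ> f \<circ> chart_inv c)
       (at (snd c p) within snd c ` {q \<in> fst c. f q \<in> fst d})"

definition riemannian_manifold :: "('a, 'e::euclidean_space) riem \<Rightarrow> bool" where
  "riemannian_manifold M \<longleftrightarrow>
     pts M \<noteq> {} \<and>
     Hausdorff_space (mfd_topology M) \<and>
     second_countable (mfd_topology M) \<and>
     (\<forall>c\<in>atlas M. is_chart (mfd_topology M) c) \<and>
     (\<Union>c\<in>atlas M. fst c) = pts M \<and>
     (\<forall>c\<in>atlas M. \<forall>d\<in>atlas M. smooth_on (snd c ` (fst c \<inter> fst d)) (snd d \<circ> chart_inv c)) \<and>
     (\<forall>c\<in>atlas M. \<forall>p\<in>fst c. inner_product (metric_tensor M c p)) \<and>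
     (\<forall>c\<in>atlas M. \<forall>v w. smooth_on (snd c ` fst c) (\<lambda>x. metric_tensor M c (chart_inv c x) v w)) \<and>
     (\<forall>c\<in>atlas M. \<forall>d\<in>atlas M. \<forall>p\<in>fst c \<inter> fst d. \<forall>v w.
        metric_tensor M d p (coord_differential c d id p v) (coord_differential c d id p w) =
        metric_tensor M c p v w)"

definition mfd_boundary :: "('a, 'e::euclidean_space) riem \<Rightarrow> 'a set" where
  "mfd_boundary M = {p. \<exists>c\<in>atlas M. p \<in> fst c \<and> snd c p \<bullet> boundary_normal = 0}"

definition tangent_norm ::
  "('a, 'e) riem \<Rightarrow> ('a, 'e) chart \<Rightarrow> 'a \<Rightarrow> 'e \<Rightarrow> real" where
  "tangent_norm M c p v = sqrt (metric_tensor M c p v v)"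

section \<open>Riemannian distance\<close>

definition smooth_curve ::
  "('a, 'e::euclidean_space) riem \<Rightarrow> (real \<Rightarrow> 'a) \<Rightarrow> real \<Rightarrow> real \<Rightarrow> bool" where
  "smooth_curve M \<gamma> a b \<longleftrightarrow>
     a < b \<and>
     (\<forall>t\<in>{a..b}. \<exists>c\<in>atlas M. \<exists>\<epsilon>>0.
        \<gamma> ` ({a..b} \<inter> ball t \<epsilon>) \<subseteq> fst c \<and> smooth_on ({a..b} \<inter> ball t \<epsilon>) (snd c \<circ> \<gamma>))"

inductive piecewise_smooth_curve ::
  "('a, 'e::euclidean_space) riem \<Rightarrow> (real \<Rightarrow> 'a) \<Rightarrow> real \<Rightarrow> real \<Rightarrow> bool" for M \<gamma> where
  smooth: "smooth_curve M \<gamma> a b \<Longrightarrow> piecewise_smooth_curve M \<gamma> a b"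
| join: "piecewise_smooth_curve M \<gamma> a c \<Longrightarrow> piecewise_smooth_curve M \<gamma> c b \<Longrightarrow>
         piecewise_smooth_curve M \<gamma> a b"

text \<open>By the transformation law of the metric the speed does not depend on the selected chart. It is
  meaningful at all but the finitely many break points and end points of a piecewise smooth curve,
  and these do not affect the length.\<close>

definition speed ::
  "('a, 'e::euclidean_space) riem \<Rightarrow> (real \<Rightarrow> 'a) \<Rightarrow> real \<Rightarrow> real" where
  "speed M \<gamma> t =
     (let c = (SOME c. c \<in> atlas M \<and> \<gamma> t \<in> fst c)
      in tangent_norm M c (\<gamma> t) (vector_derivative (snd c \<circ> \<gamma>) (at t)))"

definition curve_length ::
  "('a, 'e::euclidean_space) riem \<Rightarrow> (real \<Rightarrow> 'a) \<Rightarrow> real \<Rightarrow> real \<Rightarrow> real" where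
  "curve_length M \<gamma> a b = integral {a..b} (speed M \<gamma>)"

definition rdist :: "('a, 'e::euclidean_space) riem \<Rightarrow> 'a \<Rightarrow> 'a \<Rightarrow> real" where
  "rdist M p q =
     Inf {curve_length M \<gamma> a b | \<gamma> a b.
            piecewise_smooth_curve M \<gamma> a b \<and> \<gamma> a = p \<and> \<gamma> b = q}"

definition rdiam :: "('a, 'e::euclidean_space) riem \<Rightarrow> real" where
  "rdiam M = (SUP (p, q) \<in> pts M \<times> pts M. rdist M p q)"

section \<open>Riemannian isometric embeddings\<close>

text \<open>Smoothness of a map from an arbitrary subset \<open>A\<close> of \<open>M\<close> to \<open>N\<close>.\<close>

definition smooth_map_on ::
  "('a, 'e::euclidean_space) riem \<Rightarrow> 'a set \<Rightarrow> ('b, 'f::euclidean_space) riem \<Rightarrow> ('a \<Rightarrow> 'b) \<Rightarrow> bool"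
  where
  "smooth_map_on M A N f \<longleftrightarrow>
     A \<subseteq> pts M \<and> f ` A \<subseteq> pts N \<and>
     (\<forall>p\<in>A. \<exists>c\<in>atlas M. \<exists>d\<in>atlas N. \<exists>W.
        openin (mfd_topology M) W \<and> p \<in> W \<and> W \<subseteq> fst c \<and> f ` (A \<inter> W) \<subseteq> fst d \<and>
        smooth_on (snd c ` (A \<inter> W)) (snd d \<circ> f \<circ> chart_inv c))"

definition diffeo_onto_image ::
  "('a, 'e::euclidean_space) riem \<Rightarrow> ('b, 'f::euclidean_space) riem \<Rightarrow> ('a \<Rightarrow> 'b) \<Rightarrow> bool" where
  "diffeo_onto_image M N f \<longleftrightarrow>
     inj_on f (pts M) \<and>
     smooth_map_on M (pts M) N f \<and>
     smooth_map_on N (f ` pts M) M (inv_into (pts M) f)"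

definition riem_isometric_embedding ::
  "('a, 'e::euclidean_space) riem \<Rightarrow> ('b, 'f::euclidean_space) riem \<Rightarrow> ('a \<Rightarrow> 'b) \<Rightarrow> bool" where
  "riem_isometric_embedding M N f \<longleftrightarrow>
     diffeo_onto_image M N f \<and>
     (\<forall>c\<in>atlas M. \<forall>d\<in>atlas N. \<forall>p\<in>fst c. f p \<in> fst d \<longrightarrow>
        (\<forall>v. tangent_norm N d (f p) (coord_differential c d f p v) = tangent_norm M c p v))"

definition embedding_constant ::
  "('a, 'e::euclidean_space) riem \<Rightarrow> ('b, 'f::euclidean_space) riem \<Rightarrow> ('a \<Rightarrow> 'b) \<Rightarrow> real" where
  "embedding_constant M N f = (SUP (p, q) \<in> pts M \<times> pts M. rdist M p q - rdist N (f p) (f q))"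

definition separation ::
  "('a, 'e::euclidean_space) riem \<Rightarrow> ('b, 'f::euclidean_space) riem \<Rightarrow> ('a \<Rightarrow> 'b) \<Rightarrow> real" where
  "separation M N f =
     sqrt (embedding_constant M N f * (rdiam M + embedding_constant M N f))"

section \<open>Regions\<close>

text \<open>A region is a domain (nonempty connected open set) together with none, some or all of its
  boundary points.\<close>

definition region :: "'a topology \<Rightarrow> 'a set \<Rightarrow> bool" where
  "region X B \<longleftrightarrow>
     (\<exists>D. openin X D \<and> connectedin X D \<and> D \<noteq> {} \<and> D \<subseteq> B \<and> B \<subseteq> X closure_of D)"

section \<open>Hausdorff and Gromov--Hausdorff distance\<close>

definition tube :: "'z set \<Rightarrow> ('z \<Rightarrow> 'z \<Rightarrow> real) \<Rightarrow> real \<Rightarrow> 'z set \<Rightarrow> 'z set" where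
  "tube Z d \<rho> X = {z \<in> Z. \<exists>x\<in>X. d x z < \<rho>}"

definition hausdorff_dist ::
  "'z set \<Rightarrow> ('z \<Rightarrow> 'z \<Rightarrow> real) \<Rightarrow> 'z set \<Rightarrow> 'z set \<Rightarrow> real" where
  "hausdorff_dist Z d X1 X2 =
     Inf {\<rho>. 0 < \<rho> \<and> X1 \<subseteq> tube Z d \<rho> X2 \<and> X2 \<subseteq> tube Z d \<rho> X1}"

definition dist_preserving ::
  "'a set \<Rightarrow> ('a \<Rightarrow> 'a \<Rightarrow> real) \<Rightarrow> 'z set \<Rightarrow> ('z \<Rightarrow> 'z \<Rightarrow> real) \<Rightarrow> ('a \<Rightarrow> 'z) \<Rightarrow> bool" where
  "dist_preserving X dX Z d \<psi> \<longleftrightarrow>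
     \<psi> ` X \<subseteq> Z \<and> (\<forall>x\<in>X. \<forall>y\<in>X. d (\<psi> x) (\<psi> y) = dX x y)"

definition joint_hausdorff_dists ::
  "'a set \<Rightarrow> ('a \<Rightarrow> 'a \<Rightarrow> real) \<Rightarrow> 'b set \<Rightarrow> ('b \<Rightarrow> 'b \<Rightarrow> real) \<Rightarrow> 'z itself \<Rightarrow> real set" where
  "joint_hausdorff_dists X dX Y dY (_ :: 'z itself) =
     {hausdorff_dist Z d (\<psi>1 ` X) (\<psi>2 ` Y) | (Z :: 'z set) d \<psi>1 \<psi>2.
        Metric_space Z d \<and> dist_preserving X dX Z d \<psi>1 \<and> dist_preserving Y dY Z d \<psi>2}"

text \<open>Quantification over all metric spaces \<open>Z\<close> is rendered by metric spaces carried by subsets of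
  the type \<open>'a + 'b\<close>. Nothing is lost: only \<open>\<psi>1 ` X \<union> \<psi>2 ` Y\<close> matters for the Hausdorff
  distance, and the lemma below shows that a metric space over any type whatsoever contributes no
  further values.\<close>

definition gh_dist ::
  "'a set \<Rightarrow> ('a \<Rightarrow> 'a \<Rightarrow> real) \<Rightarrow> 'b set \<Rightarrow> ('b \<Rightarrow> 'b \<Rightarrow> real) \<Rightarrow> real" where
  "gh_dist X dX Y dY = Inf (joint_hausdorff_dists X dX Y dY TYPE('a + 'b))"

lemma joint_hausdorff_dists_any_type:
  fixes X :: "'a set" and Y :: "'b set"
  shows "joint_hausdorff_dists X dX Y dY TYPE('z) \<subseteq> joint_hausdorff_dists X dX Y dY TYPE('a + 'b)"
proof
  fix h assume "h \<in> joint_hausdorff_dists X dX Y dY TYPE('z)"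
  then obtain Z :: "'z set" and d \<psi>1 \<psi>2 where
    h: "h = hausdorff_dist Z d (\<psi>1 ` X) (\<psi>2 ` Y)" and ms: "Metric_space Z d"
    and d1: "dist_preserving X dX Z d \<psi>1" and d2: "dist_preserving Y dY Z d \<psi>2"
    unfolding joint_hausdorff_dists_def by blast
  define f where "f = (\<lambda>s. case s of Inl x \<Rightarrow> \<psi>1 x | Inr y \<Rightarrow> \<psi>2 y)"
  define S where "S = Inl ` X \<union> Inr ` Y"
  define g where "g = inv_into S f"
  define W where "W = g ` (f ` S)"
  define e where "e = (\<lambda>s t. d (f s) (f t))"
  have fS: "f ` S = \<psi>1 ` X \<union> \<psi>2 ` Y"
    by (auto simp: f_def S_def image_Un image_image)
  have fSZ: "f ` S \<subseteq> Z"
    using d1 d2 by (auto simp: fS dist_preserving_def)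
  have fg: "f (g z) = z" if "z \<in> f ` S" for z
    using that by (simp add: g_def f_inv_into_f)
  interpret Metric_space Z d by (fact ms)
  have injW: "s = t" if "s \<in> W" "t \<in> W" "f s = f t" for s t
    using that fg by (auto simp: W_def)
  have WZ: "f s \<in> Z" if "s \<in> W" for s
    using that fg fSZ by (auto simp: W_def)
  have msW: "Metric_space W e"
    by unfold_locales (use WZ injW in \<open>auto simp: e_def commute triangle\<close>)
  have p1: "dist_preserving X dX W e (g \<circ> \<psi>1)"
    using d1 fS fg by (auto simp: dist_preserving_def W_def e_def)
  have p2: "dist_preserving Y dY W e (g \<circ> \<psi>2)"
    using d2 fS fg by (auto simp: dist_preserving_def W_def e_def)
  have t: "g ` A \<subseteq> tube W e \<rho> (g ` B) \<longleftrightarrow> A \<subseteq> tube Z d \<rho> B"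
    if "A \<subseteq> f ` S" "B \<subseteq> f ` S" for A B \<rho>
  proof -
    have "g a \<in> tube W e \<rho> (g ` B) \<longleftrightarrow> a \<in> tube Z d \<rho> B" if "a \<in> A" for a
    proof -
      have a: "a \<in> f ` S" "a \<in> Z" using that \<open>A \<subseteq> f ` S\<close> fSZ by auto
      have "g a \<in> W" using a by (simp add: W_def)
      moreover have "e (g b) (g a) = d b a" if "b \<in> B" for b
        using a fg that \<open>B \<subseteq> f ` S\<close> by (auto simp: e_def)
      ultimately show ?thesis using a by (auto simp: tube_def)
    qed
    then show ?thesis by blast
  qed
  have "h = hausdorff_dist W e ((g \<circ> \<psi>1) ` X) ((g \<circ> \<psi>2) ` Y)"
    unfolding h hausdorff_dist_def image_comp[symmetric]
    using t[of "\<psi>1 ` X" "\<psi>2 ` Y"] t[of "\<psi>2 ` Y" "\<psi>1 ` X"] by (simp add: fS)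
  then show "h \<in> joint_hausdorff_dists X dX Y dY TYPE('a + 'b)"
    using msW p1 p2 unfolding joint_hausdorff_dists_def by blast
qed

end

theory Submission
  imports Defs
begin

text \<open>
  Why the estimate holds. Call \<open>x \<in> M\<^sub>1\<close> and \<open>y \<in> M\<^sub>2\<close> corresponding if \<open>d\<^sub>N (\<phi>\<^sub>1 x) (\<phi>\<^sub>2 y) < \<rho>\<close>, where
  \<open>\<rho>\<close> is an admissible radius in the definition of the Hausdorff distance of the two images. Then every point has a
  partner. An isometric embedding preserves lengths of curves, whence
  \<open>d\<^sub>N (\<phi> p) (\<phi> q) \<le> d\<^sub>M p q \<le> d\<^sub>N (\<phi> p) (\<phi> q) + C\<close>; the second inequality is the definition of the
  embedding constant. For corresponding pairs the triangle inequality in \<open>N\<close> gives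
  \<open>\<bar>d\<^sub>1 x x' - d\<^sub>2 y y'\<bar> \<le> 2 * \<rho> + max C\<^sub>1 C\<^sub>2\<close>. A correspondence of distortion \<open>2 * \<kappa>\<close> bounds the
  Gromov--Hausdorff distance by \<open>\<kappa>\<close> (\<open>gh_dist_le_correspondence\<close>), and so the distance is at most
  \<open>\<rho> + max C\<^sub>1 C\<^sub>2 / 2\<close>. Since \<open>C \<le> S\<close>, passing to the infimum over \<open>\<rho>\<close> finishes the argument.

  All infima and suprema involved have to be meaningful, and the joint metric on the disjoint
  union exists only if the intrinsic distances of \<open>M\<^sub>1\<close> and \<open>M\<^sub>2\<close> are genuine metrics, bounded by compactness.
  Most of the work therefore goes into the Riemannian distance. Any two points of a connected manifold are joined by
  a curve (\<open>connected_imp_joined_by_length\<close>), curves can be reversed and concatenated, and the speed is integrable and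
  independent of charts (\<open>speed_eq\<close>, \<open>smooth_curve_speed_integrable\<close>). Distinct points have positive distance since,
  in a compact part of a chart, the metric dominates a multiple of the Euclidean one
  (\<open>joined_by_length_bounded_below\<close>). The image of a piecewise smooth curve under a smooth map is piecewise smooth by the
  higher-order chain rule (\<open>times_differentiable_on_compose\<close>, \<open>smooth_on_compose\<close>).
\<close>

section \<open>Calculus of smooth maps\<close>

lemma times_differentiable_on_SucD:
  assumes "times_differentiable_on (Suc k) f S" "x \<in> S"
  shows "(f has_derivative frechet_derivative f (at x)) (at x)"
  using assms frechet_derivative_works by auto

lemma times_differentiable_on_continuous_on:
  "times_differentiable_on k f S \<Longrightarrow> continuous_on S f"
proof (cases k)
  case (Suc m)
  assume "times_differentiable_on k f S"
  then show ?thesis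
    by (auto simp: Suc intro!: continuous_at_imp_continuous_on differentiable_imp_continuous_within)
qed simp

lemma times_differentiable_on_subset:
  "times_differentiable_on k f S \<Longrightarrow> T \<subseteq> S \<Longrightarrow> times_differentiable_on k f T"
  by (induction k arbitrary: f) (auto intro: continuous_on_subset)

lemma times_differentiable_on_Suc_imp:
  "times_differentiable_on (Suc k) f S \<Longrightarrow> times_differentiable_on k f S"
proof (induction k arbitrary: f)
  case 0
  then show ?case using times_differentiable_on_continuous_on[of "Suc 0" f S] by simp
next
  case (Suc k)
  show ?case
    unfolding times_differentiable_on.simps(2)[of k]
    using Suc.prems Suc.IH unfolding times_differentiable_on.simps(2)[of "Suc k"] by blast
qed

lemma times_differentiable_on_cong:
  assumes "open S" "\<And>x. x \<in> S \<Longrightarrow> f x = g x" "times_differentiable_on k f S"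
  shows "times_differentiable_on k g S"
  using assms(2,3)
proof (induction k arbitrary: f g)
  case 0
  then show ?case by (simp cong: continuous_on_cong)
next
  case (Suc k)
  have g: "(g has_derivative frechet_derivative f (at x)) (at x)" if "x \<in> S" for x
    using has_derivative_transform_within_open[OF times_differentiable_on_SucD[OF Suc.prems(2) that]
        assms(1) that] Suc.prems(1) by blast
  then have eq: "frechet_derivative f (at x) = frechet_derivative g (at x)" if "x \<in> S" for x
    using frechet_derivative_at that by blast
  have "times_differentiable_on k (\<lambda>x. frechet_derivative g (at x) v) S" for v
    using Suc.IH[of "\<lambda>x. frechet_derivative f (at x) v"] eq Suc.prems(2) by simp
  then show ?case
    using g by (auto simp: differentiable_def)
qed

text \<open>The recursion through \<^const>\<open>frechet_derivative\<close> becomes usable once any function that is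
  pointwise the derivative on an open set may take its place.\<close>

lemma times_differentiable_on_SucI:
  assumes "open S" "\<And>x. x \<in> S \<Longrightarrow> (f has_derivative f' x) (at x)"
    and "\<And>v. times_differentiable_on k (\<lambda>x. f' x v) S"
  shows "times_differentiable_on (Suc k) f S"
proof -
  have eq: "f' x = frechet_derivative f (at x)" if "x \<in> S" for x
    using assms(2) that frechet_derivative_at by blast
  have "times_differentiable_on k (\<lambda>x. frechet_derivative f (at x) v) S" for v
    by (rule times_differentiable_on_cong[OF assms(1) _ assms(3)[of v]]) (simp add: eq)
  then show ?thesis
    using assms(2) by (auto simp: differentiable_def)
qed

lemma times_differentiable_on_const: "times_differentiable_on k (\<lambda>x. c) S"
  by (induction k arbitrary: c) (auto simp: frechet_derivative_const)

lemma times_differentiable_on_ident: "times_differentiable_on k (\<lambda>x. x) S"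
  by (cases k) (auto simp: frechet_derivative_ident times_differentiable_on_const continuous_on_id)

lemma times_differentiable_on_bounded_linear:
  assumes "bounded_linear L" "open S" "times_differentiable_on k f S"
  shows "times_differentiable_on k (\<lambda>x. L (f x)) S"
  using assms(3)
proof (induction k arbitrary: f)
  case 0
  then show ?case
    using bounded_linear.continuous_on[OF assms(1)] by simp
next
  case (Suc k)
  show ?case
  proof (rule times_differentiable_on_SucI[OF assms(2)])
    fix x assume "x \<in> S"
    then show "((\<lambda>x. L (f x)) has_derivative (\<lambda>v. L (frechet_derivative f (at x) v))) (at x)"
      using bounded_linear.has_derivative[OF assms(1) times_differentiable_on_SucD[OF Suc.prems]] by blast
  qed (use Suc in auto)
qed

lemma times_differentiable_on_add:
  assumes "open S" "times_differentiable_on k f S" "times_differentiable_on k g S"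
  shows "times_differentiable_on k (\<lambda>x. f x + g x) S"
  using assms(2,3)
proof (induction k arbitrary: f g)
  case 0
  then show ?case by (simp add: continuous_on_add)
next
  case (Suc k)
  show ?case
  proof (rule times_differentiable_on_SucI[OF assms(1)])
    fix x assume "x \<in> S"
    then show "((\<lambda>x. f x + g x) has_derivative
        (\<lambda>v. frechet_derivative f (at x) v + frechet_derivative g (at x) v)) (at x)"
      by (intro has_derivative_add times_differentiable_on_SucD[OF Suc.prems(1)]
          times_differentiable_on_SucD[OF Suc.prems(2)])
  qed (use Suc in auto)
qed

lemma times_differentiable_on_sum:
  assumes "open S" "finite I" "\<And>i. i \<in> I \<Longrightarrow> times_differentiable_on k (f i) S"
  shows "times_differentiable_on k (\<lambda>x. \<Sum>i\<in>I. f i x) S"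
  using assms(2,3)
  by (induction I rule: finite_induct)
    (auto intro: times_differentiable_on_add[OF assms(1)] times_differentiable_on_const)

lemma times_differentiable_on_scaleR:
  fixes f :: "'a::euclidean_space \<Rightarrow> real" and g :: "'a \<Rightarrow> 'b::euclidean_space"
  assumes "open S" "times_differentiable_on k f S" "times_differentiable_on k g S"
  shows "times_differentiable_on k (\<lambda>x. f x *\<^sub>R g x) S"
  using assms(2,3)
proof (induction k arbitrary: f g)
  case 0
  then show ?case by (simp add: continuous_on_scaleR)
next
  case (Suc k)
  show ?case
  proof (rule times_differentiable_on_SucI[OF assms(1)])
    fix x assume "x \<in> S"
    then show "((\<lambda>x. f x *\<^sub>R g x) has_derivative
        (\<lambda>v. f x *\<^sub>R frechet_derivative g (at x) v + frechet_derivative f (at x) v *\<^sub>R g x)) (at x)"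
      by (intro has_derivative_scaleR times_differentiable_on_SucD[OF Suc.prems(1)]
          times_differentiable_on_SucD[OF Suc.prems(2)])
  next
    fix v
    have "times_differentiable_on k f S" "times_differentiable_on k g S"
      using Suc.prems by (auto simp only: times_differentiable_on_Suc_imp)
    then show "times_differentiable_on k
        (\<lambda>x. f x *\<^sub>R frechet_derivative g (at x) v + frechet_derivative f (at x) v *\<^sub>R g x) S"
      using Suc.prems by (intro times_differentiable_on_add[OF assms(1)] Suc.IH) auto
  qed
qed

text \<open>In the chain rule the derivative of the outer map is evaluated at a vector that itself varies with
  the point. Expanding this vector in a basis separates the two dependences, so that the inductive
  hypothesis applies to the partial derivatives of the outer map.\<close>

lemma times_differentiable_on_compose:
  assumes "open S" "times_differentiable_on k f S" "open T" "f ` S \<subseteq> T" "times_differentiable_on k g T"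
  shows "times_differentiable_on k (\<lambda>x. g (f x)) S"
  using assms(2,5)
proof (induction k arbitrary: g)
  case 0
  then show ?case using assms(4) by (auto intro: continuous_on_compose2)
next
  case (Suc k)
  define f' where "f' x = frechet_derivative f (at x)" for x
  define g' where "g' y = frechet_derivative g (at y)" for y
  have f: "(f has_derivative f' x) (at x)" if "x \<in> S" for x
    unfolding f'_def using Suc.prems(1) that by (rule times_differentiable_on_SucD)
  have g: "(g has_derivative g' (f x)) (at (f x))" if "x \<in> S" for x
    unfolding g'_def using Suc.prems(2) that assms(4) by (intro times_differentiable_on_SucD) auto
  have expand: "g' (f x) (f' x v) = (\<Sum>b\<in>Basis. (f' x v \<bullet> b) *\<^sub>R g' (f x) b)" if "x \<in> S" for x v
  proof -
    have l: "linear (g' (f x))" using g[OF that] has_derivative_linear by blast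
    have "g' (f x) (f' x v) = g' (f x) (\<Sum>b\<in>Basis. (f' x v \<bullet> b) *\<^sub>R b)"
      by (simp add: euclidean_representation)
    then show ?thesis by (simp add: linear_sum[OF l] linear_cmul[OF l])
  qed
  show ?case
  proof (rule times_differentiable_on_SucI[OF assms(1)])
    show "((\<lambda>x. g (f x)) has_derivative (\<lambda>v. \<Sum>b\<in>Basis. (f' x v \<bullet> b) *\<^sub>R g' (f x) b)) (at x)"
      if "x \<in> S" for x
      using has_derivative_compose[OF f g, OF that that] by (simp add: expand that)
    fix v
    show "times_differentiable_on k (\<lambda>x. \<Sum>b\<in>Basis. (f' x v \<bullet> b) *\<^sub>R g' (f x) b) S"
    proof (intro times_differentiable_on_sum[OF assms(1)] times_differentiable_on_scaleR[OF assms(1)])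
      fix b :: 'b
      show "times_differentiable_on k (\<lambda>x. f' x v \<bullet> b) S"
        using Suc.prems(1) unfolding f'_def
        by (intro times_differentiable_on_bounded_linear[OF bounded_linear_inner_left assms(1)]) auto
      show "times_differentiable_on k (\<lambda>x. g' (f x) b) S"
        using Suc.IH[OF times_differentiable_on_Suc_imp[OF Suc.prems(1)], of "\<lambda>y. g' y b"] Suc.prems(2)
        unfolding g'_def by simp
    qed simp
  qed
qed

lemma smooth_onE:
  assumes "smooth_on A f" "x \<in> A"
  obtains U F where "open U" "x \<in> U" "\<forall>k. times_differentiable_on k F U" "\<forall>y\<in>A \<inter> U. F y = f y"
  using bspec[OF assms(1)[unfolded smooth_on_def] assms(2)] by (elim exE conjE) (rule that)

lemma smooth_onI:
  assumes "\<And>x. x \<in> A \<Longrightarrow> \<exists>U F. open U \<and> x \<in> U \<and> (\<forall>k. times_differentiable_on k F U) \<and>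
      (\<forall>y\<in>A \<inter> U. F y = f y)"
  shows "smooth_on A f"
  unfolding smooth_on_def using assms by (rule ballI)

lemma smooth_on_cong_subset:
  assumes "smooth_on A f" "B \<subseteq> A" "\<And>x. x \<in> B \<Longrightarrow> f x = g x"
  shows "smooth_on B g"
proof (rule smooth_onI)
  fix x assume "x \<in> B"
  with assms(2) have "x \<in> A" by blast
  obtain U F where U: "open U" "x \<in> U" "\<forall>k. times_differentiable_on k F U"
    and F: "\<forall>y\<in>A \<inter> U. F y = f y"
    by (rule smooth_onE[OF assms(1) \<open>x \<in> A\<close>])
  have "\<forall>y\<in>B \<inter> U. F y = g y"
    using F assms(2,3) by auto
  then show "\<exists>U F. open U \<and> x \<in> U \<and> (\<forall>k. times_differentiable_on k F U) \<and>
      (\<forall>y\<in>B \<inter> U. F y = g y)"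
    using U by (intro exI[of _ U] exI[of _ F] conjI)
qed

lemma smooth_on_subset: "smooth_on A f \<Longrightarrow> B \<subseteq> A \<Longrightarrow> smooth_on B f"
  by (rule smooth_on_cong_subset[of A f B f]) auto

lemma smooth_on_cong: "smooth_on A f \<Longrightarrow> (\<And>x. x \<in> A \<Longrightarrow> f x = g x) \<Longrightarrow> smooth_on A g"
  by (rule smooth_on_cong_subset[of A f A g]) auto

lemma smooth_on_globalI:
  "(\<And>k. times_differentiable_on k f UNIV) \<Longrightarrow> smooth_on A f"
  by (intro smooth_onI exI[of _ UNIV] exI[of _ f] conjI allI ballI refl) auto

lemma smooth_on_affine: "smooth_on A (\<lambda>t::real. u + t *\<^sub>R v)"
  by (intro smooth_on_globalI times_differentiable_on_add times_differentiable_on_const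
      times_differentiable_on_scaleR times_differentiable_on_ident) auto

lemma smooth_on_continuous_on:
  assumes "smooth_on A f"
  shows "continuous_on A f"
  unfolding continuous_on_eq_continuous_within
proof
  fix x assume x: "x \<in> A"
  obtain U F where U: "open U" "x \<in> U" "\<forall>k. times_differentiable_on k F U"
    and eq: "\<forall>y\<in>A \<inter> U. F y = f y"
    by (rule smooth_onE[OF assms x])
  have "continuous (at x within A) F"
    using U times_differentiable_on_continuous_on[OF U(3)[rule_format]]
    by (simp add: continuous_on_eq_continuous_at continuous_at_imp_continuous_at_within)
  moreover have "eventually (\<lambda>y. F y = f y) (at x within A)"
    using U(1,2) eq unfolding eventually_at_topological by auto
  ultimately show "continuous (at x within A) f"
    using tendsto_cong[of F f "at x within A" "f x"] bspec[OF eq, of x] x U(2) unfolding continuous_within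
    by simp
qed

lemma smooth_on_compose:
  assumes f: "smooth_on A f" and g: "smooth_on B g" and "f ` A \<subseteq> B"
  shows "smooth_on A (\<lambda>x. g (f x))"
proof (rule smooth_onI)
  fix x assume x: "x \<in> A"
  obtain U F where U: "open U" "x \<in> U" "\<forall>k. times_differentiable_on k F U"
    and F: "\<forall>y\<in>A \<inter> U. F y = f y"
    by (rule smooth_onE[OF f x])
  have "f x \<in> B" using x assms(3) by blast
  obtain V G where V: "open V" "f x \<in> V" "\<forall>k. times_differentiable_on k G V"
    and G: "\<forall>y\<in>B \<inter> V. G y = g y"
    by (rule smooth_onE[OF g \<open>f x \<in> B\<close>])
  define W where "W = U \<inter> F -` V"
  have W: "open W"
    using continuous_open_preimage[OF times_differentiable_on_continuous_on[OF U(3)[rule_format]] U(1) V(1)]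
    by (simp add: W_def)
  have "\<forall>k. times_differentiable_on k (\<lambda>y. G (F y)) W"
    by (intro allI, rule times_differentiable_on_compose[OF W times_differentiable_on_subset[OF U(3)[rule_format]] V(1) _ V(3)[rule_format]])
      (auto simp: W_def)
  moreover have "x \<in> W" using U(2) V(2) F x by (auto simp: W_def)
  moreover have "\<forall>y\<in>A \<inter> W. G (F y) = g (f y)"
    using F G assms(3) by (auto simp: W_def image_subset_iff)
  ultimately show "\<exists>U F. open U \<and> x \<in> U \<and> (\<forall>k. times_differentiable_on k F U) \<and>
      (\<forall>y\<in>A \<inter> U. F y = g (f y))"
    using W by (intro exI[of _ W] exI[of _ "\<lambda>y. G (F y)"] conjI)
qed

lemma smooth_on_imp_differentiable:
  assumes "smooth_on A f" "x \<in> A"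
  shows "f differentiable (at x within A)"
proof -
  obtain U F where U: "open U" "x \<in> U" "\<forall>k. times_differentiable_on k F U"
    and F: "\<forall>y\<in>A \<inter> U. F y = f y"
    by (rule smooth_onE[OF assms])
  have "(F has_derivative frechet_derivative F (at x)) (at x within A)"
    using times_differentiable_on_SucD[OF U(3)[rule_format]] U(2) has_derivative_at_withinI by blast
  moreover have "eventually (\<lambda>y. F y = f y) (at x within A)"
    using U(1,2) F unfolding eventually_at_topological by auto
  ultimately have "(f has_derivative frechet_derivative F (at x)) (at x within A)"
    using F assms(2) U(2) by (intro has_derivative_transform_eventually[of F _ x A f]) auto
  then show ?thesis unfolding differentiable_def by blast
qed

section \<open>Charts and the metric tensor\<close>

lemma is_chart_subset: "is_chart X c \<Longrightarrow> fst c \<subseteq> topspace X"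
  by (simp add: is_chart_def openin_subset)

lemma is_chart_topspace: "is_chart X c \<Longrightarrow> topspace (subtopology X (fst c)) = fst c"
  using is_chart_subset by fastforce

lemma is_chart_inj: "is_chart X c \<Longrightarrow> inj_on (snd c) (fst c)"
  using homeomorphic_imp_injective_map is_chart_topspace unfolding is_chart_def by metis

lemma chart_inv_eq: "is_chart X c \<Longrightarrow> p \<in> fst c \<Longrightarrow> chart_inv c (snd c p) = p"
  by (simp add: is_chart_inj)

lemma is_chart_image_half_space: "is_chart X c \<Longrightarrow> snd c ` fst c \<subseteq> half_space"
  unfolding is_chart_def by (metis openin_imp_subset)

lemma is_chart_open_image:
  assumes c: "is_chart X c" and W: "openin X W" "W \<subseteq> fst c"
  shows "openin (top_of_set half_space) (snd c ` W)"
proof -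
  have "openin (subtopology X (fst c)) W"
    using W by (simp add: openin_subset_topspace_eq openin_subtopology Int_absorb2) blast
  then have "openin (top_of_set (snd c ` fst c)) (snd c ` W)"
    using c homeomorphic_imp_open_map unfolding is_chart_def open_map_def by blast
  then show ?thesis
    using c openin_trans unfolding is_chart_def by blast
qed

lemma is_chart_open_preimage:
  assumes c: "is_chart X c" and "open V"
  shows "openin X {p \<in> fst c. snd c p \<in> V}"
proof -
  have "continuous_map (subtopology X (fst c)) (top_of_set (snd c ` fst c)) (snd c)"
    using c homeomorphic_imp_continuous_map unfolding is_chart_def by blast
  moreover have "openin (top_of_set (snd c ` fst c)) (snd c ` fst c \<inter> V)"
    using \<open>open V\<close> by blast
  ultimately have "openin (subtopology X (fst c))
      {p \<in> topspace (subtopology X (fst c)). snd c p \<in> snd c ` fst c \<inter> V}"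
    by (rule openin_continuous_map_preimage)
  moreover have "{p \<in> topspace (subtopology X (fst c)). snd c p \<in> snd c ` fst c \<inter> V} =
      {p \<in> fst c. snd c p \<in> V}"
    using is_chart_topspace[OF c] by auto
  ultimately show ?thesis
    using c openin_trans_full unfolding is_chart_def by metis
qed

lemma is_chart_compactin:
  assumes c: "is_chart X c" and K: "compact K" "K \<subseteq> snd c ` fst c"
  shows "compactin X {p \<in> fst c. snd c p \<in> K}"
proof -
  let ?P = "{p \<in> fst c. snd c p \<in> K}"
  have "snd c ` ?P = K" using K(2) by auto
  moreover have "compactin (top_of_set (snd c ` fst c)) K"
    using K by (simp add: compactin_subtopology)
  ultimately have "compactin (subtopology X (fst c)) ?P"
    using homeomorphic_map_compactness[of "subtopology X (fst c)" _ "snd c" ?P] c is_chart_topspace[OF c]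
    unfolding is_chart_def by auto
  then show ?thesis by (simp add: compactin_subtopology)
qed

locale riemannian =
  fixes M :: "('a, 'e::euclidean_space) riem"
  assumes riemannian: "riemannian_manifold M"
begin

lemma pts_nonempty: "pts M \<noteq> {}"
  and Hausdorff: "Hausdorff_space (mfd_topology M)"
  and chart: "c \<in> atlas M \<Longrightarrow> is_chart (mfd_topology M) c"
  and transition_smooth: "c \<in> atlas M \<Longrightarrow> d \<in> atlas M \<Longrightarrow>
    smooth_on (snd c ` (fst c \<inter> fst d)) (snd d \<circ> chart_inv c)"
  and inner_product: "c \<in> atlas M \<Longrightarrow> p \<in> fst c \<Longrightarrow> inner_product (metric_tensor M c p)"
  and metric_smooth: "c \<in> atlas M \<Longrightarrow>
    smooth_on (snd c ` fst c) (\<lambda>x. metric_tensor M c (chart_inv c x) v w)"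
  and metric_transition: "c \<in> atlas M \<Longrightarrow> d \<in> atlas M \<Longrightarrow> p \<in> fst c \<inter> fst d \<Longrightarrow>
    metric_tensor M d p (coord_differential c d id p v) (coord_differential c d id p w) =
    metric_tensor M c p v w"
  using riemannian unfolding riemannian_manifold_def by blast+

lemma in_some_chart: "p \<in> pts M \<Longrightarrow> \<exists>c\<in>atlas M. p \<in> fst c"
  using riemannian unfolding riemannian_manifold_def by blast

lemma chart_subset: "c \<in> atlas M \<Longrightarrow> fst c \<subseteq> pts M"
  using chart is_chart_subset by blast

lemma chart_open: "c \<in> atlas M \<Longrightarrow> openin (mfd_topology M) (fst c)"
  using chart is_chart_def by blast

lemma tangent_norm_nonneg:
  assumes "c \<in> atlas M" "p \<in> fst c"
  shows "0 \<le> tangent_norm M c p v"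
proof -
  have "bilinear (metric_tensor M c p)" "v \<noteq> 0 \<Longrightarrow> 0 < metric_tensor M c p v v"
    using inner_product[OF assms] unfolding inner_product_def by auto
  then have "0 \<le> metric_tensor M c p v v"
    by (cases "v = 0") (auto simp: bilinear_lzero)
  then show ?thesis by (simp add: tangent_norm_def)
qed

lemma tangent_norm_pos:
  assumes "c \<in> atlas M" "p \<in> fst c" "v \<noteq> 0"
  shows "0 < tangent_norm M c p v"
  using inner_product[OF assms(1,2)] assms(3) unfolding inner_product_def tangent_norm_def by simp

lemma tangent_norm_scaleR:
  assumes "c \<in> atlas M" "p \<in> fst c"
  shows "tangent_norm M c p (s *\<^sub>R v) = \<bar>s\<bar> * tangent_norm M c p v"
proof -
  have "bilinear (metric_tensor M c p)"
    using inner_product[OF assms] unfolding inner_product_def by blast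
  then have "metric_tensor M c p (s *\<^sub>R v) (s *\<^sub>R v) = s\<^sup>2 * metric_tensor M c p v v"
    by (simp add: bilinear_lmul bilinear_rmul power2_eq_square)
  then show ?thesis by (simp add: tangent_norm_def real_sqrt_mult)
qed

lemma tangent_norm_zero: "c \<in> atlas M \<Longrightarrow> p \<in> fst c \<Longrightarrow> tangent_norm M c p 0 = 0"
  using tangent_norm_scaleR[of c p 0 0] by simp

lemma continuous_on_tangent_norm:
  assumes c: "c \<in> atlas M" and x: "continuous_on I x" "x ` I \<subseteq> snd c ` fst c" and v: "continuous_on I v"
  shows "continuous_on I (\<lambda>t. tangent_norm M c (chart_inv c (x t)) (v t))"
proof -
  let ?g = "\<lambda>t. metric_tensor M c (chart_inv c (x t))"
  have g: "?g t (v t) (v t) = (\<Sum>(i, j)\<in>Basis \<times> Basis. (v t \<bullet> i) * (v t \<bullet> j) * ?g t i j)"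
    if "t \<in> I" for t
  proof -
    have "x t \<in> snd c ` fst c" using that x(2) by blast
    then have "chart_inv c (x t) \<in> fst c" by (rule inv_into_into)
    then have bil: "bilinear (?g t)"
      using inner_product[OF c] unfolding inner_product_def by blast
    have "?g t (v t) (v t) = ?g t (\<Sum>i\<in>Basis. (v t \<bullet> i) *\<^sub>R i) (\<Sum>j\<in>Basis. (v t \<bullet> j) *\<^sub>R j)"
      by (simp add: euclidean_representation)
    also have "\<dots> = (\<Sum>(i, j)\<in>Basis \<times> Basis. ?g t ((v t \<bullet> i) *\<^sub>R i) ((v t \<bullet> j) *\<^sub>R j))"
      by (rule bilinear_sum[OF bil])
    also have "\<dots> = (\<Sum>(i, j)\<in>Basis \<times> Basis. (v t \<bullet> i) * (v t \<bullet> j) * ?g t i j)"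
      by (intro sum.cong refl) (auto simp: bilinear_lmul[OF bil] bilinear_rmul[OF bil])
    finally show ?thesis .
  qed
  have "continuous_on I (\<lambda>t. ?g t i j)" for i j
    using smooth_on_continuous_on[OF metric_smooth[OF c]] x by (rule continuous_on_compose2)
  then have "continuous_on I (\<lambda>t. \<Sum>(i, j)\<in>Basis \<times> Basis. (v t \<bullet> i) * (v t \<bullet> j) * ?g t i j)"
    unfolding split_beta by (intro continuous_intros v)
  then have "continuous_on I (\<lambda>t. ?g t (v t) (v t))"
    using g by (simp cong: continuous_on_cong)
  then show ?thesis
    unfolding tangent_norm_def by (rule continuous_on_real_sqrt)
qed

text \<open>On the compact product of \<open>K\<close> with the unit sphere the tangent norm is continuous and positive;
  homogeneity extends the resulting bounds to all vectors.\<close>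

lemma tangent_norm_compact_bounds:
  assumes c: "c \<in> atlas M" and K: "compact K" "K \<subseteq> snd c ` fst c"
  obtains m B where "0 < m" "0 \<le> B"
    "\<And>p v. p \<in> fst c \<Longrightarrow> snd c p \<in> K \<Longrightarrow> m * norm v \<le> tangent_norm M c p v"
    "\<And>p v. p \<in> fst c \<Longrightarrow> snd c p \<in> K \<Longrightarrow> tangent_norm M c p v \<le> B * norm v"
proof (cases "K = {}")
  case True
  then show ?thesis using that[of 1 0] by simp
next
  case False
  define f where "f z = tangent_norm M c (chart_inv c (fst z)) (snd z)" for z :: "'e \<times> 'e"
  let ?S = "K \<times> sphere (0::'e) 1"
  have cont: "continuous_on ?S f"
    unfolding f_def using K(2)
    by (intro continuous_on_tangent_norm[OF c] continuous_intros) auto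
  have cS: "compact ?S" using K(1) by (simp add: compact_Times)
  obtain b :: 'e where "b \<in> Basis" using nonempty_Basis by blast
  then have ne: "?S \<noteq> {}" using False by auto
  obtain z0 where z0: "z0 \<in> ?S" "\<forall>z\<in>?S. f z0 \<le> f z"
    using continuous_attains_inf[OF cS ne cont] by blast
  obtain z1 where z1: "z1 \<in> ?S" "\<forall>z\<in>?S. f z \<le> f z1"
    using continuous_attains_sup[OF cS ne cont] by blast
  have pos: "0 < f z0"
    unfolding f_def using z0(1) K(2)
    by (intro tangent_norm_pos[OF c]) (auto intro!: inv_into_into)
  have "f z0 \<le> f z1" using z0(2) z1(1) by blast
  then have "0 \<le> f z1" using pos by linarith
  moreover have "f z0 * norm v \<le> tangent_norm M c p v \<and> tangent_norm M c p v \<le> f z1 * norm v"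
    if p: "p \<in> fst c" "snd c p \<in> K" for p v
  proof (cases "v = 0")
    case True
    then show ?thesis using tangent_norm_zero[OF c p(1)] by simp
  next
    case False
    define u where "u = v /\<^sub>R norm v"
    have u: "(snd c p, u) \<in> ?S" and v: "v = norm v *\<^sub>R u"
      using p(2) False by (auto simp: u_def)
    have "f (snd c p, u) = tangent_norm M c p u"
      using chart_inv_eq[OF chart[OF c] p(1)] by (simp add: f_def)
    moreover have "tangent_norm M c p v = norm v * tangent_norm M c p u"
      by (subst v) (simp add: tangent_norm_scaleR[OF c p(1)])
    moreover have "f z0 \<le> f (snd c p, u)" "f (snd c p, u) \<le> f z1"
      using z0(2) z1(2) u by blast+
    ultimately show ?thesis
      by (simp add: mult.commute mult_left_mono)
  qed
  ultimately show ?thesis using that pos by blast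
qed

end

section \<open>Curves and their speed\<close>

text \<open>The coordinate differential of a map is a derivative within a relatively open subset of the half space,
  hence one-sided at the boundary. A curve through an interior parameter stays in the coordinate domain for nearby
  parameters, so the chain rule applies although the outer derivative is one-sided.\<close>

lemma coord_differential_curve:
  assumes c: "is_chart X c" and W: "openin X W" "W \<subseteq> fst c" and fW: "f ` W \<subseteq> fst d"
    and smooth: "smooth_on (snd c ` W) (snd d \<circ> f \<circ> chart_inv c)"
    and near: "open T" "t \<in> T" "\<gamma> ` T \<subseteq> W"
    and v: "((snd c \<circ> \<gamma>) has_vector_derivative v) (at t)"
  shows "((snd d \<circ> f \<circ> \<gamma>) has_vector_derivative coord_differential c d f (\<gamma> t) v) (at t)"
proof -
  let ?S = "snd c ` {q \<in> fst c. f q \<in> fst d}"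
  let ?f = "snd d \<circ> f \<circ> chart_inv c"
  obtain V where V: "open V" "snd c ` W = half_space \<inter> V"
    using is_chart_open_image[OF c W] by (auto simp: openin_open)
  \<comment> \<open>Near the base point \<open>?S\<close> is the image of \<open>W\<close>, on which the coordinate map is known to be smooth.\<close>
  have SV: "?S \<inter> V = snd c ` W"
    using is_chart_image_half_space[OF c] V(2) W(2) fW by blast
  have tW: "\<gamma> t \<in> W" using near by blast
  then have x: "snd c (\<gamma> t) \<in> snd c ` W" by blast
  then have xV: "snd c (\<gamma> t) \<in> V" "snd c (\<gamma> t) \<in> ?S" using SV by blast+
  have "?f differentiable (at (snd c (\<gamma> t)) within ?S \<inter> V)"
    using smooth_on_imp_differentiable[OF smooth x] SV by simp
  then have "?f differentiable (at (snd c (\<gamma> t)) within ?S)"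
    using at_within_nhd[OF xV(1) V(1), of "?S \<inter> V" ?S] by (simp add: inf.absorb1 Int_assoc)
  then have D: "(?f has_derivative coord_differential c d f (\<gamma> t)) (at (snd c (\<gamma> t)) within ?S)"
    unfolding coord_differential_def by (simp add: frechet_derivative_works)
  have S: "(snd c \<circ> \<gamma>) ` T \<subseteq> ?S" using near(3) W(2) fW by fastforce
  have v': "((snd c \<circ> \<gamma>) has_derivative (\<lambda>h. h *\<^sub>R v)) (at t within T)"
    using v has_vector_derivative_def has_derivative_at_withinI by blast
  have "(?f has_derivative coord_differential c d f (\<gamma> t))
      (at ((snd c \<circ> \<gamma>) t) within (snd c \<circ> \<gamma>) ` T)"
    using has_derivative_subset[OF D S] by simp
  with v' have "((\<lambda>s. ?f ((snd c \<circ> \<gamma>) s)) has_derivative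
      (\<lambda>h. coord_differential c d f (\<gamma> t) (h *\<^sub>R v))) (at t within T)"
    by (rule has_derivative_in_compose)
  then have "((\<lambda>s. ?f ((snd c \<circ> \<gamma>) s)) has_derivative
      (\<lambda>h. h *\<^sub>R coord_differential c d f (\<gamma> t) v)) (at t)"
    unfolding linear_scale[OF has_derivative_linear[OF D]] at_within_open[OF near(2,1)] .
  then have "((\<lambda>s. ?f ((snd c \<circ> \<gamma>) s)) has_vector_derivative coord_differential c d f (\<gamma> t) v) (at t)"
    unfolding has_vector_derivative_def .
  then show ?thesis
  proof (rule has_vector_derivative_transform_within_open[OF _ near(1,2)])
    fix s assume "s \<in> T"
    then have "\<gamma> s \<in> fst c" using near(3) W(2) by blast
    then show "?f ((snd c \<circ> \<gamma>) s) = (snd d \<circ> f \<circ> \<gamma>) s"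
      using chart_inv_eq[OF c] by simp
  qed
qed

context riemannian
begin

text \<open>The transformation law of the metric makes the speed independent of the chart that
  \<^const>\<open>speed\<close> happens to select.\<close>

lemma speed_eq:
  assumes c: "c \<in> atlas M" and near: "open T" "t \<in> T" "\<gamma> ` T \<subseteq> fst c"
    and v: "((snd c \<circ> \<gamma>) has_vector_derivative v) (at t)"
  shows "speed M \<gamma> t = tangent_norm M c (\<gamma> t) v"
proof -
  define d where "d = (SOME d. d \<in> atlas M \<and> \<gamma> t \<in> fst d)"
  have t: "\<gamma> t \<in> fst c" using near by blast
  then have "d \<in> atlas M \<and> \<gamma> t \<in> fst d"
    unfolding d_def using c by (intro someI[of "\<lambda>d. d \<in> atlas M \<and> \<gamma> t \<in> fst d" c] conjI)
  then have d: "d \<in> atlas M" "\<gamma> t \<in> fst d" by auto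
  let ?W = "fst c \<inter> fst d"
  have W: "openin (mfd_topology M) ?W" by (intro openin_Int chart_open c d(1))
  obtain V where V: "open V" "snd c ` ?W = half_space \<inter> V"
    using is_chart_open_image[OF chart[OF c] W Int_lower1] by (auto simp: openin_open)
  have "snd c (\<gamma> t) \<in> V" using V(2) t d(2) by blast
  moreover have "isCont (snd c \<circ> \<gamma>) t" using v has_vector_derivative_continuous by blast
  ultimately obtain T' where T': "open T'" "t \<in> T'" "\<And>s. s \<in> T' \<Longrightarrow> (snd c \<circ> \<gamma>) s \<in> V"
    using V(1) unfolding continuous_at_open by (metis comp_apply)
  have sub: "\<gamma> ` (T \<inter> T') \<subseteq> ?W"
  proof
    fix p assume "p \<in> \<gamma> ` (T \<inter> T')"
    then obtain s where s: "p = \<gamma> s" "s \<in> T" "s \<in> T'" by blast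
    have p: "p \<in> fst c" using s near(3) by blast
    moreover have "snd c p \<in> half_space" using p is_chart_image_half_space[OF chart[OF c]] by blast
    ultimately have "snd c p \<in> snd c ` ?W" using V(2) T'(3)[OF s(3)] s(1) by auto
    then show "p \<in> ?W" using p is_chart_inj[OF chart[OF c]] by (auto dest: inj_onD)
  qed
  have "((snd d \<circ> id \<circ> \<gamma>) has_vector_derivative coord_differential c d id (\<gamma> t) v) (at t)"
  proof (rule coord_differential_curve[OF chart[OF c] W])
    show "smooth_on (snd c ` ?W) (snd d \<circ> id \<circ> chart_inv c)"
      using transition_smooth[OF c d(1)] by simp
    show "open (T \<inter> T')" "t \<in> T \<inter> T'" using near T' by auto
  qed (use sub v in auto)
  then have "vector_derivative (snd d \<circ> \<gamma>) (at t) = coord_differential c d id (\<gamma> t) v"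
    using vector_derivative_at by force
  then have "speed M \<gamma> t = tangent_norm M d (\<gamma> t) (coord_differential c d id (\<gamma> t) v)"
    unfolding speed_def d_def Let_def by simp
  then show ?thesis
    unfolding tangent_norm_def using metric_transition[OF c d(1), of "\<gamma> t"] t d(2) by simp
qed

text \<open>The definition of a smooth curve provides one chart around each parameter. Transition maps carry
  smoothness over to any other chart, and continuity allows the curve to be confined to any open set.\<close>

lemma smooth_curve_in_chart:
  assumes \<gamma>: "smooth_curve M \<gamma> a b" and t: "t \<in> {a..b}"
    and c: "c \<in> atlas M" and W: "openin (mfd_topology M) W" "W \<subseteq> fst c" "\<gamma> t \<in> W"
  obtains \<epsilon> where "0 < \<epsilon>" "\<gamma> ` ({a..b} \<inter> ball t \<epsilon>) \<subseteq> W"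
    "smooth_on ({a..b} \<inter> ball t \<epsilon>) (snd c \<circ> \<gamma>)"
proof -
  obtain d e where d: "d \<in> atlas M" and e: "0 < e" "\<gamma> ` ({a..b} \<inter> ball t e) \<subseteq> fst d"
    and sm: "smooth_on ({a..b} \<inter> ball t e) (snd d \<circ> \<gamma>)"
    using bspec[OF conjunct2[OF \<gamma>[unfolded smooth_curve_def]] t] by blast
  let ?I = "{a..b} \<inter> ball t e" and ?W = "W \<inter> fst d"
  have tI: "t \<in> ?I" using t e(1) by simp
  have "openin (mfd_topology M) ?W" by (intro openin_Int W(1) chart_open d)
  then obtain V where V: "open V" "snd d ` ?W = half_space \<inter> V"
    using is_chart_open_image[OF chart[OF d] _ Int_lower2] by (auto simp: openin_open)
  have "\<gamma> t \<in> ?W" using W(3) e(2) tI by blast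
  then have "(snd d \<circ> \<gamma>) t \<in> V" using V(2) by auto
  then obtain r where r: "0 < r" "ball ((snd d \<circ> \<gamma>) t) r \<subseteq> V" using V(1) openE by blast
  then obtain e' where e': "0 < e'" "\<forall>s\<in>?I. dist s t < e' \<longrightarrow> dist ((snd d \<circ> \<gamma>) s) ((snd d \<circ> \<gamma>) t) < r"
    using smooth_on_continuous_on[OF sm] tI unfolding continuous_on_iff by blast
  have e'V: "(snd d \<circ> \<gamma>) s \<in> V" if "s \<in> ?I" "dist s t < e'" for s
    using r(2) e'(2) that by (auto simp: dist_commute)
  define \<epsilon> where "\<epsilon> = min e e'"
  let ?J = "{a..b} \<inter> ball t \<epsilon>"
  have J: "?J \<subseteq> ?I" by (auto simp: \<epsilon>_def)
  have inW: "\<gamma> s \<in> ?W" if "s \<in> ?J" for s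
  proof -
    have s: "s \<in> ?I" "dist s t < e'" using that by (auto simp: \<epsilon>_def dist_commute)
    have p: "\<gamma> s \<in> fst d" using s(1) e(2) by blast
    moreover have "snd d (\<gamma> s) \<in> half_space" using p is_chart_image_half_space[OF chart[OF d]] by blast
    ultimately have "snd d (\<gamma> s) \<in> snd d ` ?W" using V(2) e'V[OF s] by simp
    then show ?thesis using p is_chart_inj[OF chart[OF d]] by (auto dest: inj_onD)
  qed
  have "smooth_on ?J (\<lambda>s. (snd c \<circ> chart_inv d) ((snd d \<circ> \<gamma>) s))"
    using smooth_on_subset[OF sm J] transition_smooth[OF d c]
  proof (rule smooth_on_compose)
    show "(snd d \<circ> \<gamma>) ` ?J \<subseteq> snd d ` (fst d \<inter> fst c)"
    proof (rule image_subsetI)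
      fix s assume "s \<in> ?J"
      then have "\<gamma> s \<in> fst d \<inter> fst c" using inW W(2) by blast
      then show "(snd d \<circ> \<gamma>) s \<in> snd d ` (fst d \<inter> fst c)" by simp
    qed
  qed
  then have "smooth_on ?J (snd c \<circ> \<gamma>)"
    by (rule smooth_on_cong) (use inW chart_inv_eq[OF chart[OF d]] in auto)
  moreover have "\<gamma> ` ?J \<subseteq> W" using inW by blast
  ultimately show ?thesis
    using that[of \<epsilon>] e(1) e'(1) by (simp add: \<epsilon>_def)
qed

lemma smooth_curve_in_pts: "smooth_curve M \<gamma> a b \<Longrightarrow> t \<in> {a..b} \<Longrightarrow> \<gamma> t \<in> pts M"
  unfolding smooth_curve_def using chart_subset by fastforce

lemma piecewise_smooth_curve_in_pts:
  "piecewise_smooth_curve M \<gamma> a b \<Longrightarrow> t \<in> {a..b} \<Longrightarrow> \<gamma> t \<in> pts M"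
proof (induction arbitrary: t rule: piecewise_smooth_curve.induct)
  case (join a c b)
  then show ?case by (cases "t \<le> c") auto
qed (rule smooth_curve_in_pts)

lemma smooth_curve_speed:
  assumes \<gamma>: "smooth_curve M \<gamma> a b" and t: "a < t" "t < b" and c: "c \<in> atlas M" "\<gamma> t \<in> fst c"
  obtains v where "((snd c \<circ> \<gamma>) has_vector_derivative v) (at t)"
    "speed M \<gamma> t = tangent_norm M c (\<gamma> t) v"
proof -
  have t': "t \<in> {a..b}" using t by simp
  obtain e where e: "0 < e" "\<gamma> ` ({a..b} \<inter> ball t e) \<subseteq> fst c"
    "smooth_on ({a..b} \<inter> ball t e) (snd c \<circ> \<gamma>)"
    by (rule smooth_curve_in_chart[OF \<gamma> t' c(1) chart_open[OF c(1)] order_refl c(2)])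
  let ?T = "{a<..<b} \<inter> ball t e"
  have T: "open ?T" "t \<in> ?T" "?T \<subseteq> {a..b} \<inter> ball t e" using t e(1) by auto
  have "(snd c \<circ> \<gamma>) differentiable (at t within ?T)"
    using smooth_on_imp_differentiable[OF smooth_on_subset[OF e(3) T(3)] T(2)] .
  then have "((snd c \<circ> \<gamma>) has_vector_derivative vector_derivative (snd c \<circ> \<gamma>) (at t)) (at t)"
    unfolding at_within_open[OF T(2,1)] by (simp only: vector_derivative_works)
  moreover from this have "speed M \<gamma> t = tangent_norm M c (\<gamma> t) (vector_derivative (snd c \<circ> \<gamma>) (at t))"
    using e(2) T by (intro speed_eq[OF c(1) T(1,2)]) auto
  ultimately show ?thesis using that by blast
qed

lemma speed_nonneg: "\<gamma> t \<in> pts M \<Longrightarrow> 0 \<le> speed M \<gamma> t"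
proof -
  assume "\<gamma> t \<in> pts M"
  then obtain c where "c \<in> atlas M \<and> \<gamma> t \<in> fst c" using in_some_chart by blast
  then have "(SOME c. c \<in> atlas M \<and> \<gamma> t \<in> fst c) \<in> atlas M \<and> \<gamma> t \<in> fst (SOME c. c \<in> atlas M \<and> \<gamma> t \<in> fst c)"
    by (rule someI)
  then show ?thesis unfolding speed_def Let_def using tangent_norm_nonneg by blast
qed

text \<open>Near each parameter the speed agrees, away from the two end points, with a function that is continuous
  up to the end points: the derivative of the coordinate curve is replaced by the derivative of a smooth extension.\<close>

lemma smooth_curve_speed_integrable:
  assumes \<gamma>: "smooth_curve M \<gamma> a b"
  shows "speed M \<gamma> integrable_on {a..b}"
proof -
  have "speed M \<gamma> integrable_on cbox a b"
  proof (rule integrable_on_little_subintervals, rule ballI)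
    fix t assume "t \<in> cbox a b"
    then have t: "t \<in> {a..b}" by simp
    then obtain c where c: "c \<in> atlas M" "\<gamma> t \<in> fst c"
      using in_some_chart smooth_curve_in_pts[OF \<gamma>] by blast
    obtain e where e: "0 < e" "\<gamma> ` ({a..b} \<inter> ball t e) \<subseteq> fst c"
      "smooth_on ({a..b} \<inter> ball t e) (snd c \<circ> \<gamma>)"
      by (rule smooth_curve_in_chart[OF \<gamma> t c(1) chart_open[OF c(1)] order_refl c(2)])
    have tI: "t \<in> {a..b} \<inter> ball t e" using t e(1) by simp
    obtain U F where U: "open U" "t \<in> U" "\<forall>k. times_differentiable_on k F U"
      and F: "\<forall>y\<in>({a..b} \<inter> ball t e) \<inter> U. F y = (snd c \<circ> \<gamma>) y"
      by (rule smooth_onE[OF e(3) tI])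
    obtain e' where e': "0 < e'" "ball t e' \<subseteq> U" using openE[OF U(1,2)] by blast
    \<comment> \<open>The derivative of the extension \<open>F\<close>, continuous also at the end points.\<close>
    define D where "D s = frechet_derivative F (at s) 1" for s
    have D: "(F has_vector_derivative D s) (at s)" if "s \<in> U" for s
    proof -
      have F': "(F has_derivative frechet_derivative F (at s)) (at s)"
        using times_differentiable_on_SucD[OF U(3)[rule_format] that] .
      have "frechet_derivative F (at s) h = h *\<^sub>R D s" for h
        using linear_scale[OF has_derivative_linear[OF F'], of h 1] by (simp only: D_def real_scaleR_def mult_1_right)
      then have "frechet_derivative F (at s) = (\<lambda>h. h *\<^sub>R D s)" by (rule ext)
      with F' show ?thesis unfolding has_vector_derivative_def by (simp only:)
    qed
    have contD: "continuous_on U D"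
      using spec[OF U(3), of "Suc 0"] unfolding D_def by simp
    have contF: "continuous_on U F"
      using times_differentiable_on_continuous_on[OF spec[OF U(3)]] .
    show "\<exists>d>0. \<forall>u v. t \<in> cbox u v \<and> cbox u v \<subseteq> ball t d \<and> cbox u v \<subseteq> cbox a b \<longrightarrow>
        speed M \<gamma> integrable_on cbox u v"
    proof (intro exI[of _ "min e e'"] conjI allI impI)
      fix u v assume "t \<in> cbox u v \<and> cbox u v \<subseteq> ball t (min e e') \<and> cbox u v \<subseteq> cbox a b"
      then have "cbox u v \<subseteq> ball t (min e e')" "cbox u v \<subseteq> {a..b}" by simp_all
      moreover have "ball t (min e e') \<subseteq> ball t e \<inter> U" using e'(2) by auto
      ultimately have sub: "cbox u v \<subseteq> ({a..b} \<inter> ball t e) \<inter> U" by blast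
      have img: "F s = snd c (\<gamma> s) \<and> \<gamma> s \<in> fst c" if "s \<in> cbox u v" for s
      proof -
        have "s \<in> {a..b} \<inter> ball t e \<inter> U" using that sub by blast
        then show ?thesis using F e(2) by auto
      qed
      have "continuous_on (cbox u v) (\<lambda>s. tangent_norm M c (chart_inv c (F s)) (D s))"
        using sub img
        by (intro continuous_on_tangent_norm[OF c(1)] continuous_on_subset[OF contF]
            continuous_on_subset[OF contD]) auto
      then have "(\<lambda>s. tangent_norm M c (chart_inv c (F s)) (D s)) integrable_on cbox u v"
        by (rule integrable_continuous)
      then show "speed M \<gamma> integrable_on cbox u v"
      proof (rule integrable_spike_finite[of "{a, b}", rotated 2])
        fix s assume s: "s \<in> cbox u v - {a, b}"
        let ?T = "{a<..<b} \<inter> ball t e \<inter> U"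
        have sI: "s \<in> {a..b} \<inter> ball t e \<inter> U" using s sub by blast
        have T: "open ?T" using U(1) by (intro open_Int open_greaterThanLessThan open_ball)
        have T: "open ?T" "s \<in> ?T" using T sI s by auto
        have "((snd c \<circ> \<gamma>) has_vector_derivative D s) (at s)"
          by (rule has_vector_derivative_transform_within_open[OF D T]) (use sI T F in auto)
        then have "speed M \<gamma> s = tangent_norm M c (\<gamma> s) (D s)"
          using e(2) by (intro speed_eq[OF c(1) T]) auto
        then show "speed M \<gamma> s = tangent_norm M c (chart_inv c (F s)) (D s)"
          using img[of s] s chart_inv_eq[OF chart[OF c(1)]] by simp
      qed simp
    qed (use e(1) e'(1) in auto)
  qed
  then show ?thesis by simp
qed

end

lemma piecewise_smooth_curve_less: "piecewise_smooth_curve M \<gamma> a b \<Longrightarrow> a < b"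
  by (induction rule: piecewise_smooth_curve.induct) (auto simp: smooth_curve_def)

context riemannian
begin

lemma piecewise_smooth_curve_speed_integrable:
  "piecewise_smooth_curve M \<gamma> a b \<Longrightarrow> speed M \<gamma> integrable_on {a..b}"
proof (induction rule: piecewise_smooth_curve.induct)
  case (join a c b)
  then show ?case
    using piecewise_smooth_curve_less[of M \<gamma>] by (intro Henstock_Kurzweil_Integration.integrable_combine[of a c b]) force+
qed (rule smooth_curve_speed_integrable)

lemma curve_length_join:
  assumes "piecewise_smooth_curve M \<gamma> a c" "piecewise_smooth_curve M \<gamma> c b"
  shows "curve_length M \<gamma> a b = curve_length M \<gamma> a c + curve_length M \<gamma> c b"
  unfolding curve_length_def
  using assms[THEN piecewise_smooth_curve_less]
    piecewise_smooth_curve_speed_integrable[OF piecewise_smooth_curve.join[OF assms]]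
  by (intro Henstock_Kurzweil_Integration.integral_combine[symmetric]) auto

lemma curve_length_nonneg:
  "piecewise_smooth_curve M \<gamma> a b \<Longrightarrow> 0 \<le> curve_length M \<gamma> a b"
  unfolding curve_length_def
  by (intro Henstock_Kurzweil_Integration.integral_nonneg piecewise_smooth_curve_speed_integrable
      speed_nonneg piecewise_smooth_curve_in_pts)

end

section \<open>Operations on curves\<close>

text \<open>Curves are total functions on the reals, so concatenation needs that smoothness and length depend only
  on the values on the parameter interval. At the end points of the interval the speed may still depend on the values
  outside; these points do not affect the integral.\<close>

lemma speed_cong:
  assumes "open T" "t \<in> T" "\<And>s. s \<in> T \<Longrightarrow> \<gamma> s = \<gamma>' s"
  shows "speed M \<gamma> t = speed M \<gamma>' t"
proof -
  have t: "\<gamma> t = \<gamma>' t" using assms by blast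
  have ev: "\<forall>\<^sub>F s in nhds t. s \<in> UNIV \<longrightarrow> (snd d \<circ> \<gamma>) s = (snd d \<circ> \<gamma>') s" for d :: "('a, 'b) chart"
    unfolding eventually_nhds using assms by (intro exI[of _ T]) simp
  have "vector_derivative (snd d \<circ> \<gamma>) (at t) = vector_derivative (snd d \<circ> \<gamma>') (at t)"
    for d :: "('a, 'b) chart"
    by (rule vector_derivative_cong_eq[OF ev refl refl UNIV_I])
  then show ?thesis by (simp only: speed_def t)
qed

lemma curve_length_cong:
  assumes "\<And>t. t \<in> {a..b} \<Longrightarrow> \<gamma> t = \<gamma>' t"
  shows "curve_length M \<gamma> a b = curve_length M \<gamma>' a b"
proof -
  have "speed M \<gamma> t = speed M \<gamma>' t" if "t \<in> {a<..<b}" for t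
    using that assms by (intro speed_cong[of "{a<..<b}"]) auto
  then show ?thesis
    unfolding curve_length_def integral_open_interval_real
    by (rule Henstock_Kurzweil_Integration.integral_cong)
qed

lemma smooth_curve_cong:
  assumes \<gamma>: "smooth_curve M \<gamma> a b" and eq: "\<And>t. t \<in> {a..b} \<Longrightarrow> \<gamma> t = \<gamma>' t"
  shows "smooth_curve M \<gamma>' a b"
  unfolding smooth_curve_def
proof (intro conjI ballI)
  show "a < b" using \<gamma> by (simp add: smooth_curve_def)
  fix t assume "t \<in> {a..b}"
  then obtain c e where c: "c \<in> atlas M" "0 < e" "\<gamma> ` ({a..b} \<inter> ball t e) \<subseteq> fst c"
    and sm: "smooth_on ({a..b} \<inter> ball t e) (snd c \<circ> \<gamma>)"
    using bspec[OF conjunct2[OF \<gamma>[unfolded smooth_curve_def]]] by blast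
  have "smooth_on ({a..b} \<inter> ball t e) (snd c \<circ> \<gamma>')"
    using sm by (rule smooth_on_cong) (simp add: eq)
  moreover have "\<gamma>' ` ({a..b} \<inter> ball t e) \<subseteq> fst c"
    using c(3) eq by (simp add: image_subset_iff)
  ultimately show "\<exists>c\<in>atlas M. \<exists>\<epsilon>>0. \<gamma>' ` ({a..b} \<inter> ball t \<epsilon>) \<subseteq> fst c \<and>
      smooth_on ({a..b} \<inter> ball t \<epsilon>) (snd c \<circ> \<gamma>')"
    using c(1,2) by blast
qed

lemma piecewise_smooth_curve_cong:
  assumes "piecewise_smooth_curve M \<gamma> a b" "\<And>t. t \<in> {a..b} \<Longrightarrow> \<gamma> t = \<gamma>' t"
  shows "piecewise_smooth_curve M \<gamma>' a b"
  using assms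
proof (induction rule: piecewise_smooth_curve.induct)
  case (smooth a b)
  show ?case
    by (rule piecewise_smooth_curve.smooth, rule smooth_curve_cong[OF smooth.hyps smooth.prems])
next
  case (join a c b)
  have "a < c" "c < b" using join.hyps piecewise_smooth_curve_less by blast+
  then have "piecewise_smooth_curve M \<gamma>' a c" "piecewise_smooth_curve M \<gamma>' c b"
    using join.IH join.prems by auto
  then show ?case by (rule piecewise_smooth_curve.join)
qed

lemma smooth_curve_reverse:
  assumes \<gamma>: "smooth_curve M \<gamma> a b"
  shows "smooth_curve M (\<lambda>t. \<gamma> (h - t)) (h - b) (h - a)"
  unfolding smooth_curve_def
proof (intro conjI ballI)
  show "h - b < h - a" using \<gamma> by (simp add: smooth_curve_def)
  fix t assume "t \<in> {h - b..h - a}"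
  then have "h - t \<in> {a..b}" by auto
  then obtain c e where c: "c \<in> atlas M" "0 < e" "\<gamma> ` ({a..b} \<inter> ball (h - t) e) \<subseteq> fst c"
    and sm: "smooth_on ({a..b} \<inter> ball (h - t) e) (snd c \<circ> \<gamma>)"
    using bspec[OF conjunct2[OF \<gamma>[unfolded smooth_curve_def]]] by blast
  let ?J = "{h - b..h - a} \<inter> ball t e"
  have J: "(\<lambda>s. h + s *\<^sub>R (- 1)) ` ?J \<subseteq> {a..b} \<inter> ball (h - t) e"
    by (auto simp: dist_real_def)
  have "smooth_on ?J (\<lambda>s. (snd c \<circ> \<gamma>) (h + s *\<^sub>R (- 1)))"
    using smooth_on_affine sm J by (rule smooth_on_compose)
  then have "smooth_on ?J (snd c \<circ> (\<lambda>s. \<gamma> (h - s)))"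
    by (rule smooth_on_cong) simp
  moreover have "(\<lambda>s. \<gamma> (h - s)) ` ?J \<subseteq> fst c"
  proof (rule image_subsetI)
    fix s assume "s \<in> ?J"
    then have "h - s \<in> {a..b} \<inter> ball (h - t) e" by (auto simp: dist_real_def)
    then show "\<gamma> (h - s) \<in> fst c" using c(3) by blast
  qed
  ultimately show "\<exists>c\<in>atlas M. \<exists>\<epsilon>>0. (\<lambda>s. \<gamma> (h - s)) ` ({h - b..h - a} \<inter> ball t \<epsilon>) \<subseteq> fst c \<and>
      smooth_on ({h - b..h - a} \<inter> ball t \<epsilon>) (snd c \<circ> (\<lambda>s. \<gamma> (h - s)))"
    using c(1,2) by blast
qed

lemma piecewise_smooth_curve_reverse:
  "piecewise_smooth_curve M \<gamma> a b \<Longrightarrow>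
    piecewise_smooth_curve M (\<lambda>t. \<gamma> (h - t)) (h - b) (h - a)"
proof (induction rule: piecewise_smooth_curve.induct)
  case (smooth a b)
  then show ?case by (intro piecewise_smooth_curve.smooth smooth_curve_reverse)
next
  case (join a c b)
  from join.IH(2,1) show ?case by (rule piecewise_smooth_curve.join)
qed

lemma has_vector_derivative_reverse:
  assumes "(f has_vector_derivative v) (at (h - t))"
  shows "((\<lambda>s::real. f (h - s)) has_vector_derivative - v) (at t)"
proof -
  have "((\<lambda>s. h - s) has_vector_derivative 0 - 1) (at t)"
    by (rule has_vector_derivative_diff[OF has_vector_derivative_const has_vector_derivative_id])
  from vector_diff_chain_at[OF this assms] show ?thesis
    by (simp add: o_def)
qed

lemma integral_reverse:
  fixes f :: "real \<Rightarrow> real"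
  assumes "f integrable_on {a..b}"
  shows "integral {h - b..h - a} (\<lambda>t. f (h - t)) = integral {a..b} f"
proof -
  have "(f has_integral integral {a..b} f) (cbox a b)"
    using assms by (simp add: has_integral_integral)
  from has_integral_affinity[OF this, of "-1" h]
  have "((\<lambda>t. f (h - t)) has_integral integral {a..b} f) ((\<lambda>t. h - t) ` {a..b})"
    by simp
  moreover have "(\<lambda>t. h - t) ` {a..b} = {h - b..h - a}" by simp
  ultimately show ?thesis by (simp add: integral_unique)
qed

context riemannian
begin

text \<open>Where the coordinate curve is differentiable, the two derivatives differ by a sign. Elsewhere
  \<^const>\<open>vector_derivative\<close> selects by the same unsatisfiable predicate on both sides.\<close>

lemma speed_reverse:
  assumes "\<gamma> (h - t) \<in> pts M"
  shows "speed M (\<lambda>s. \<gamma> (h - s)) t = speed M \<gamma> (h - t)"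
proof -
  define d where "d = (SOME d. d \<in> atlas M \<and> \<gamma> (h - t) \<in> fst d)"
  obtain c where "c \<in> atlas M \<and> \<gamma> (h - t) \<in> fst c" using in_some_chart[OF assms] by blast
  then have "d \<in> atlas M \<and> \<gamma> (h - t) \<in> fst d" unfolding d_def by (rule someI)
  then have d: "d \<in> atlas M" "\<gamma> (h - t) \<in> fst d" by auto
  let ?g = "snd d \<circ> \<gamma>" and ?r = "snd d \<circ> (\<lambda>s. \<gamma> (h - s))"
  have r: "?r = (\<lambda>s. ?g (h - s))" by (simp add: o_def)
  have rev: "(?r has_vector_derivative - v) (at t)" if "(?g has_vector_derivative v) (at (h - t))" for v
    unfolding r by (rule has_vector_derivative_reverse[OF that])
  have rev': "(?g has_vector_derivative - v) (at (h - t))" if "(?r has_vector_derivative v) (at t)" for v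
    using has_vector_derivative_reverse[of ?r v h "h - t"] that by (simp add: o_def)
  have "tangent_norm M d (\<gamma> (h - t)) (vector_derivative ?r (at t)) =
      tangent_norm M d (\<gamma> (h - t)) (vector_derivative ?g (at (h - t)))"
  proof (cases "\<exists>v. (?g has_vector_derivative v) (at (h - t))")
    case True
    then obtain v where v: "(?g has_vector_derivative v) (at (h - t))" by blast
    show ?thesis
      using vector_derivative_at[OF v] vector_derivative_at[OF rev[OF v]]
        tangent_norm_scaleR[OF d, of "-1" v] by simp
  next
    case False
    then have "\<not> (?r has_vector_derivative v) (at t)" for v using rev' by blast
    with False show ?thesis unfolding vector_derivative_def by simp
  qed
  then show ?thesis unfolding speed_def Let_def d_def .
qed

lemma curve_length_reverse:
  assumes "piecewise_smooth_curve M \<gamma> a b"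
  shows "curve_length M (\<lambda>t. \<gamma> (h - t)) (h - b) (h - a) = curve_length M \<gamma> a b"
proof -
  have "curve_length M (\<lambda>t. \<gamma> (h - t)) (h - b) (h - a) =
      integral {h - b..h - a} (\<lambda>t. speed M \<gamma> (h - t))"
    unfolding curve_length_def
    by (intro Henstock_Kurzweil_Integration.integral_cong speed_reverse piecewise_smooth_curve_in_pts[OF assms]) auto
  also have "\<dots> = curve_length M \<gamma> a b"
    unfolding curve_length_def
    by (rule integral_reverse[OF piecewise_smooth_curve_speed_integrable[OF assms]])
  finally show ?thesis .
qed

lemma piecewise_smooth_curve_shift:
  assumes "piecewise_smooth_curve M \<gamma> a b"
  shows "piecewise_smooth_curve M (\<lambda>t. \<gamma> (t - h)) (a + h) (b + h)"
    and "curve_length M (\<lambda>t. \<gamma> (t - h)) (a + h) (b + h) = curve_length M \<gamma> a b"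
proof -
  \<comment> \<open>A translation is a composition of two reflections.\<close>
  note 1 = piecewise_smooth_curve_reverse[OF assms, of 0] curve_length_reverse[OF assms, of 0]
  show "piecewise_smooth_curve M (\<lambda>t. \<gamma> (t - h)) (a + h) (b + h)"
    using piecewise_smooth_curve_reverse[OF 1(1), of h] by (simp add: add.commute)
  show "curve_length M (\<lambda>t. \<gamma> (t - h)) (a + h) (b + h) = curve_length M \<gamma> a b"
    using curve_length_reverse[OF 1(1), of h] 1(2) by (simp add: add.commute)
qed

end

text \<open>The curve and its parameter interval are hidden behind an existential quantifier; what remains is
  all that matters for the infimum in \<^const>\<open>rdist\<close>.\<close>

definition joined_by_length :: "('a, 'e::euclidean_space) riem \<Rightarrow> 'a \<Rightarrow> 'a \<Rightarrow> real \<Rightarrow> bool" where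
  "joined_by_length M p q L \<longleftrightarrow>
     (\<exists>\<gamma> a b. piecewise_smooth_curve M \<gamma> a b \<and> \<gamma> a = p \<and> \<gamma> b = q \<and> curve_length M \<gamma> a b = L)"

lemma rdist_eq: "rdist M p q = Inf (Collect (joined_by_length M p q))"
  unfolding rdist_def joined_by_length_def by (rule arg_cong[of _ _ Inf]) blast

lemma joined_by_lengthI:
  "piecewise_smooth_curve M \<gamma> a b \<Longrightarrow> joined_by_length M (\<gamma> a) (\<gamma> b) (curve_length M \<gamma> a b)"
  unfolding joined_by_length_def by blast

context riemannian
begin

lemma joined_by_length_nonneg: "joined_by_length M p q L \<Longrightarrow> 0 \<le> L"
  unfolding joined_by_length_def using curve_length_nonneg by blast

lemma joined_by_length_sym:
  assumes "joined_by_length M p q L"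
  shows "joined_by_length M q p L"
proof -
  obtain \<gamma> a b where \<gamma>: "piecewise_smooth_curve M \<gamma> a b" "\<gamma> a = p" "\<gamma> b = q" "curve_length M \<gamma> a b = L"
    using assms unfolding joined_by_length_def by blast
  show ?thesis
    using joined_by_lengthI[OF piecewise_smooth_curve_reverse[OF \<gamma>(1), of 0]]
      curve_length_reverse[OF \<gamma>(1), of 0] \<gamma>(2-4) by simp
qed

lemma joined_by_length_trans:
  assumes "joined_by_length M p q L" "joined_by_length M q r L'"
  shows "joined_by_length M p r (L + L')"
proof -
  obtain \<gamma> a b where \<gamma>: "piecewise_smooth_curve M \<gamma> a b" "\<gamma> a = p" "\<gamma> b = q" "curve_length M \<gamma> a b = L"
    using assms(1) unfolding joined_by_length_def by blast
  obtain \<delta> a' b' where \<delta>: "piecewise_smooth_curve M \<delta> a' b'" "\<delta> a' = q" "\<delta> b' = r"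
    "curve_length M \<delta> a' b' = L'"
    using assms(2) unfolding joined_by_length_def by blast
  define h where "h = b - a'"
  define \<sigma> where "\<sigma> t = (if t \<le> b then \<gamma> t else \<delta> (t - h))" for t
  have ab: "a < b" "b < b' + h"
    using piecewise_smooth_curve_less[OF \<gamma>(1)] piecewise_smooth_curve_less[OF \<delta>(1)] by (auto simp: h_def)
  have \<delta>': "piecewise_smooth_curve M (\<lambda>t. \<delta> (t - h)) b (b' + h)"
    "curve_length M (\<lambda>t. \<delta> (t - h)) b (b' + h) = L'"
    using piecewise_smooth_curve_shift[OF \<delta>(1), of h] \<delta>(4) by (simp_all add: h_def)
  have eq1: "\<gamma> t = \<sigma> t" if "t \<in> {a..b}" for t using that by (simp add: \<sigma>_def)
  have eq2: "\<delta> (t - h) = \<sigma> t" if "t \<in> {b..b' + h}" for t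
    using that \<gamma>(3) \<delta>(2) by (cases "t = b") (auto simp: \<sigma>_def h_def)
  have 1: "piecewise_smooth_curve M \<sigma> a b" by (rule piecewise_smooth_curve_cong[OF \<gamma>(1) eq1])
  have 2: "piecewise_smooth_curve M \<sigma> b (b' + h)" by (rule piecewise_smooth_curve_cong[OF \<delta>'(1) eq2])
  have "curve_length M \<sigma> a (b' + h) = L + L'"
    using curve_length_join[OF 1 2] curve_length_cong[of a b \<gamma> \<sigma> M, OF eq1]
      curve_length_cong[of b "b' + h" "\<lambda>t. \<delta> (t - h)" \<sigma> M, OF eq2] \<gamma>(4) \<delta>'(2) by simp
  moreover have "\<sigma> a = p" "\<sigma> (b' + h) = r" using ab \<gamma>(2) \<delta>(3) by (auto simp: \<sigma>_def)
  moreover have "joined_by_length M (\<sigma> a) (\<sigma> (b' + h)) (curve_length M \<sigma> a (b' + h))"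
    by (rule joined_by_lengthI[OF piecewise_smooth_curve.join[OF 1 2]])
  ultimately show ?thesis by metis
qed

text \<open>A straight segment in a chart is a smooth curve whose speed is the tangent norm of a constant
  vector.\<close>

lemma joined_by_coordinate_segment:
  assumes c: "c \<in> atlas M" and p: "p \<in> fst c" and q: "q \<in> fst c"
    and seg: "closed_segment (snd c p) (snd c q) \<subseteq> K" "K \<subseteq> snd c ` fst c"
    and B: "\<And>z v. z \<in> fst c \<Longrightarrow> snd c z \<in> K \<Longrightarrow> tangent_norm M c z v \<le> B * norm v"
  obtains L where "L \<le> B * norm (snd c q - snd c p)" "joined_by_length M p q L"
proof -
  define v where "v = snd c q - snd c p"
  define \<gamma> where "\<gamma> t = chart_inv c (snd c p + t *\<^sub>R v)" for t
  have K: "snd c p + t *\<^sub>R v \<in> K" if "t \<in> {0..1}" for t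
  proof -
    have "snd c p + t *\<^sub>R v = (1 - t) *\<^sub>R snd c p + t *\<^sub>R snd c q"
      unfolding v_def by (simp add: scaleR_diff_left scaleR_diff_right)
    then have "snd c p + t *\<^sub>R v \<in> closed_segment (snd c p) (snd c q)"
      using that unfolding closed_segment_def atLeastAtMost_iff by blast
    then show ?thesis using seg(1) by blast
  qed
  have \<gamma>: "snd c (\<gamma> t) = snd c p + t *\<^sub>R v" "\<gamma> t \<in> fst c" if "t \<in> {0..1}" for t
  proof -
    have "snd c p + t *\<^sub>R v \<in> snd c ` fst c" using K[OF that] seg(2) by blast
    then show "snd c (\<gamma> t) = snd c p + t *\<^sub>R v" "\<gamma> t \<in> fst c"
      unfolding \<gamma>_def by (rule f_inv_into_f, rule inv_into_into)
  qed
  have img: "\<gamma> ` ({0..1} \<inter> ball t 1) \<subseteq> fst c" for t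
  proof (rule image_subsetI)
    fix s assume "s \<in> {0..1} \<inter> ball t 1"
    then show "\<gamma> s \<in> fst c" by (intro \<gamma>(2)) blast
  qed
  have sm: "smooth_on ({0..1} \<inter> ball t 1) (snd c \<circ> \<gamma>)" for t
    using smooth_on_affine[of "{0..1} \<inter> ball t 1" "snd c p" v]
  proof (rule smooth_on_cong)
    fix s assume "s \<in> {0..1} \<inter> ball t 1"
    then show "snd c p + s *\<^sub>R v = (snd c \<circ> \<gamma>) s" using \<gamma>(1)[of s] by simp
  qed
  have smooth: "smooth_curve M \<gamma> 0 1"
    unfolding smooth_curve_def
    by (intro conjI ballI bexI[OF _ c] exI[of _ 1] img sm) simp_all
  have pc: "piecewise_smooth_curve M \<gamma> 0 1" by (rule piecewise_smooth_curve.smooth[OF smooth])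
  have speed: "speed M \<gamma> t \<le> B * norm v" if t: "t \<in> {0<..<1}" for t
  proof -
    have "((\<lambda>t. snd c p + t *\<^sub>R v) has_derivative (\<lambda>h. 0 + h *\<^sub>R v)) (at t)"
      by (intro has_derivative_add has_derivative_const has_derivative_scaleR_left has_derivative_ident)
    then have "((\<lambda>t. snd c p + t *\<^sub>R v) has_vector_derivative v) (at t)"
      by (simp add: has_vector_derivative_def)
    then have "((snd c \<circ> \<gamma>) has_vector_derivative v) (at t)"
      by (rule has_vector_derivative_transform_within_open[OF _ open_greaterThanLessThan t])
        (use \<gamma>(1) in auto)
    moreover have "\<gamma> ` {0<..<1} \<subseteq> fst c" using \<gamma>(2) by auto
    ultimately have "speed M \<gamma> t = tangent_norm M c (\<gamma> t) v"
      using t by (intro speed_eq[OF c open_greaterThanLessThan])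
    also have "\<dots> \<le> B * norm v" using \<gamma>[of t] K[of t] t by (intro B) auto
    finally show ?thesis .
  qed
  have "integral {0<..<1} (speed M \<gamma>) \<le> integral {0<..<1} (\<lambda>t::real. B * norm v)"
    using piecewise_smooth_curve_speed_integrable[OF pc] speed
    by (intro Henstock_Kurzweil_Integration.integral_le) (auto simp: integrable_on_open_interval_real)
  then have "curve_length M \<gamma> 0 1 \<le> B * norm v"
    unfolding curve_length_def by (simp add: integral_open_interval_real[symmetric])
  moreover have "\<gamma> 0 = p" "\<gamma> 1 = q"
    using chart_inv_eq[OF chart[OF c]] p q by (auto simp: \<gamma>_def v_def)
  ultimately show ?thesis
    using that[of "curve_length M \<gamma> 0 1"] joined_by_lengthI[OF pc] unfolding v_def by metis
qed

end

section \<open>The Riemannian distance is a metric\<close>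

context riemannian
begin

lemma half_space_closed_convex: "closed (half_space :: 'e set)" "convex (half_space :: 'e set)"
  unfolding half_space_def
  using closed_halfspace_ge[of 0 "boundary_normal :: 'e"] convex_halfspace_ge[of 0 "boundary_normal :: 'e"]
  by (simp_all add: inner_commute)

lemma coordinate_ball:
  assumes c: "c \<in> atlas M" and p: "p \<in> fst c"
  obtains r where "0 < r" "half_space \<inter> cball (snd c p) r \<subseteq> snd c ` fst c"
proof -
  obtain V where V: "open V" "snd c ` fst c = half_space \<inter> V"
    using is_chart_open_image[OF chart[OF c] chart_open[OF c] order_refl] by (auto simp: openin_open)
  have "snd c p \<in> V" using V(2) p by blast
  then obtain r where "0 < r" "cball (snd c p) r \<subseteq> V"
    using V(1) open_contains_cball by blast
  then show ?thesis using that V(2) by blast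
qed

text \<open>The intersection of the half space with a coordinate ball around \<open>p\<close> is compact and convex. Coordinate segments from
  \<open>p\<close> remain in it, and their speed is bounded there. The uniform bound on the lengths is
  what makes the diameter of a compact manifold finite.\<close>

lemma locally_joined_by_length:
  assumes "p \<in> pts M"
  obtains V B where "openin (mfd_topology M) V" "p \<in> V"
    "\<forall>q\<in>V. \<exists>L\<le>B. joined_by_length M p q L"
proof -
  obtain c where c: "c \<in> atlas M" "p \<in> fst c" using in_some_chart[OF assms] by blast
  obtain r where r: "0 < r" "half_space \<inter> cball (snd c p) r \<subseteq> snd c ` fst c"
    by (rule coordinate_ball[OF c])
  let ?K = "half_space \<inter> cball (snd c p) r"
  have "compact ?K" using half_space_closed_convex(1) by (simp add: closed_Int_compact)
  then obtain m B where B: "0 \<le> B"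
      "\<And>z v. z \<in> fst c \<Longrightarrow> snd c z \<in> ?K \<Longrightarrow> tangent_norm M c z v \<le> B * norm v"
    using tangent_norm_compact_bounds[OF c(1) _ r(2)] by metis
  define V where "V = {q \<in> fst c. snd c q \<in> ball (snd c p) r}"
  have V: "openin (mfd_topology M) V"
    unfolding V_def by (rule is_chart_open_preimage[OF chart[OF c(1)] open_ball])
  have pV: "p \<in> V" using c(2) r(1) by (simp add: V_def)
  have "\<exists>L\<le>B * r. joined_by_length M p q L" if q: "q \<in> V" for q
  proof -
    have qc: "q \<in> fst c" "norm (snd c q - snd c p) \<le> r"
      using q by (auto simp: V_def dist_norm norm_minus_commute)
    have hs: "snd c p \<in> half_space" "snd c q \<in> half_space"
      using is_chart_image_half_space[OF chart[OF c(1)]] c(2) qc(1) by blast+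
    have "closed_segment (snd c p) (snd c q) \<subseteq> ?K"
    proof (rule closed_segment_subset)
      show "convex ?K" by (rule convex_Int[OF half_space_closed_convex(2) convex_cball])
    qed (use hs qc(2) r(1) in \<open>auto simp: dist_norm norm_minus_commute\<close>)
    then obtain L where L: "L \<le> B * norm (snd c q - snd c p)" "joined_by_length M p q L"
      by (rule joined_by_coordinate_segment[OF c qc(1) _ r(2) B(2)])
    moreover have "B * norm (snd c q - snd c p) \<le> B * r" using qc(2) B(1) by (rule mult_left_mono)
    ultimately show ?thesis by (intro exI[of _ L]) simp
  qed
  then show ?thesis by (intro that[OF V pV] ballI)
qed

lemma joined_by_length_refl:
  assumes "p \<in> pts M"
  shows "joined_by_length M p p 0"
proof -
  obtain c where c: "c \<in> atlas M" "p \<in> fst c" using in_some_chart[OF assms] by blast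
  obtain m B where B:
    "\<And>z v. z \<in> fst c \<Longrightarrow> snd c z \<in> {snd c p} \<Longrightarrow> tangent_norm M c z v \<le> B * norm v"
    using tangent_norm_compact_bounds[OF c(1), of "{snd c p}"] c(2)
    by (metis compact_sing empty_subsetI imageI insert_subset)
  obtain L where L: "L \<le> B * norm (snd c p - snd c p)" "joined_by_length M p p L"
    by (rule joined_by_coordinate_segment[where K = "{snd c p}" and B = B, OF c c(2) _ _ B])
      (use c(2) in auto)
  have "L = 0" using L(1) joined_by_length_nonneg[OF L(2)] by simp
  with L(2) show ?thesis by simp
qed

text \<open>The set of points that a given point can be joined to is open by local joinability, and so is its
  complement.\<close>

lemma connected_imp_joined_by_length:
  assumes con: "connected_space (mfd_topology M)" and p: "p \<in> pts M" and q: "q \<in> pts M"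
  shows "\<exists>L. joined_by_length M p q L"
proof -
  define A where "A = {z \<in> pts M. \<exists>L. joined_by_length M p z L}"
  have nbhd: "\<exists>V. openin (mfd_topology M) V \<and> z \<in> V \<and> (\<forall>y\<in>V. y \<in> A \<longleftrightarrow> z \<in> A)" if z: "z \<in> pts M" for z
  proof -
    obtain V B where V: "openin (mfd_topology M) V" "z \<in> V"
      and B: "\<forall>y\<in>V. \<exists>L\<le>B. joined_by_length M z y L"
      by (rule locally_joined_by_length[OF z])
    have "y \<in> A \<longleftrightarrow> z \<in> A" if y: "y \<in> V" for y
    proof -
      have yp: "y \<in> pts M" using y V(1) openin_subset by blast
      obtain L where L: "joined_by_length M z y L" using bspec[OF B y] by blast
      show ?thesis
        using joined_by_length_trans[OF _ L, of p] joined_by_length_trans[OF _ joined_by_length_sym[OF L], of p]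
          yp z unfolding A_def by blast
    qed
    then show ?thesis using V by blast
  qed
  have 1: "openin (mfd_topology M) A"
  proof (subst openin_subopen, rule ballI)
    fix z assume z: "z \<in> A"
    then have "z \<in> pts M" by (simp add: A_def)
    with nbhd z show "\<exists>T. openin (mfd_topology M) T \<and> z \<in> T \<and> T \<subseteq> A" by (metis subsetI)
  qed
  have 2: "openin (mfd_topology M) (pts M - A)"
  proof (subst openin_subopen, rule ballI)
    fix z assume z: "z \<in> pts M - A"
    then obtain V where V: "openin (mfd_topology M) V" "z \<in> V" "\<forall>y\<in>V. y \<in> A \<longleftrightarrow> z \<in> A"
      using nbhd by blast
    then have "V \<subseteq> pts M - A" using z openin_subset by blast
    with V show "\<exists>T. openin (mfd_topology M) T \<and> z \<in> T \<and> T \<subseteq> pts M - A" by blast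
  qed
  have "closedin (mfd_topology M) A"
    using 2 unfolding closedin_def by (auto simp: A_def)
  with con 1 have "A = {} \<or> A = pts M"
    unfolding connected_space_clopen_in by blast
  moreover have "p \<in> A" using p joined_by_length_refl by (auto simp: A_def)
  ultimately show ?thesis using q by (auto simp: A_def)
qed

text \<open>Bisection reduces the estimate to short parameter intervals whose image lies in \<open>V1\<close> or in \<open>V2\<close>. On
  \<open>V2\<close> the function does not change at all. On \<open>V1\<close> the fundamental theorem of calculus, applied to the
  coordinate curve, bounds \<open>m\<close> times the coordinate displacement by the integral of the speed.\<close>

lemma smooth_curve_length_ge:
  fixes u :: "'a \<Rightarrow> real"
  assumes \<gamma>: "smooth_curve M \<gamma> a b"
    and V: "openin (mfd_topology M) V1" "openin (mfd_topology M) V2" "pts M \<subseteq> V1 \<union> V2"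
    and c: "c \<in> atlas M" "V1 \<subseteq> fst c"
    and m: "0 \<le> m" "\<And>p v. p \<in> V1 \<Longrightarrow> m * norm v \<le> tangent_norm M c p v"
    and u1: "\<And>p q. p \<in> V1 \<Longrightarrow> q \<in> V1 \<Longrightarrow> \<bar>u p - u q\<bar> \<le> m * norm (snd c p - snd c q)"
    and u2: "\<And>p q. p \<in> V2 \<Longrightarrow> q \<in> V2 \<Longrightarrow> u p = u q"
  shows "\<bar>u (\<gamma> b) - u (\<gamma> a)\<bar> \<le> curve_length M \<gamma> a b"
proof -
  have ab: "a < b" using \<gamma> by (simp add: smooth_curve_def)
  have int: "speed M \<gamma> integrable_on {s..t}" if "a \<le> s" "t \<le> b" for s t
    using integrable_on_subinterval[OF smooth_curve_speed_integrable[OF \<gamma>]] that by simp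
  define P where "P s t \<longleftrightarrow> (a \<le> s \<longrightarrow> s \<le> t \<longrightarrow> t \<le> b \<longrightarrow>
    \<bar>u (\<gamma> t) - u (\<gamma> s)\<bar> \<le> integral {s..t} (speed M \<gamma>))" for s t
  have "P a b"
  proof (rule Bolzano)
    show "a \<le> b" using ab by simp
    show "P x z" if "P x y" "P y z" "x \<le> y" "y \<le> z" for x y z
    proof -
      have "integral {x..y} (speed M \<gamma>) + integral {y..z} (speed M \<gamma>) = integral {x..z} (speed M \<gamma>)"
        if "a \<le> x" "z \<le> b"
        using \<open>x \<le> y\<close> \<open>y \<le> z\<close> int[OF that]
        by (intro Henstock_Kurzweil_Integration.integral_combine)
      then show ?thesis using that unfolding P_def by force
    qed
    fix x assume x: "a \<le> x" "x \<le> b"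
    then have xI: "x \<in> {a..b}" by simp
    have xp: "\<gamma> x \<in> pts M" by (rule smooth_curve_in_pts[OF \<gamma> xI])
    show "\<exists>d>0. \<forall>s t. s \<le> x \<and> x \<le> t \<and> t - s < d \<longrightarrow> P s t"
    proof (cases "\<gamma> x \<in> V1")
      case True
      obtain e where e: "0 < e" "\<gamma> ` ({a..b} \<inter> ball x e) \<subseteq> V1"
        "smooth_on ({a..b} \<inter> ball x e) (snd c \<circ> \<gamma>)"
        by (rule smooth_curve_in_chart[OF \<gamma> xI c(1) V(1) c(2) True])
      have "P s t" if st: "s \<le> x" "x \<le> t" "t - s < e" for s t
        unfolding P_def
      proof (intro impI)
        assume s: "a \<le> s" "s \<le> t" "t \<le> b"
        have sub: "{s..t} \<subseteq> {a..b} \<inter> ball x e" using s st by (auto simp: dist_real_def)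
        then have V1: "\<gamma> \<tau> \<in> V1" if "\<tau> \<in> {s..t}" for \<tau> using that e(2) by blast
        let ?g = "snd c \<circ> \<gamma>"
        let ?D = "\<lambda>\<tau>. vector_derivative ?g (at \<tau>)"
        have D: "(?g has_vector_derivative ?D \<tau>) (at \<tau>) \<and> norm (m *\<^sub>R ?D \<tau>) \<le> speed M \<gamma> \<tau>"
          if \<tau>: "\<tau> \<in> {s<..<t}" for \<tau>
        proof -
          have \<tau>1: "\<gamma> \<tau> \<in> V1" "a < \<tau>" "\<tau> < b" using V1[of \<tau>] \<tau> s by auto
          then have "\<gamma> \<tau> \<in> fst c" using c(2) by blast
          then obtain v where v: "(?g has_vector_derivative v) (at \<tau>)" "speed M \<gamma> \<tau> = tangent_norm M c (\<gamma> \<tau>) v"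
            by (rule smooth_curve_speed[OF \<gamma> \<tau>1(2,3) c(1)])
          have "?D \<tau> = v" by (rule vector_derivative_at[OF v(1)])
          with v m(2)[OF \<tau>1(1), of v] m(1) show ?thesis by simp
        qed
        have "continuous_on {s..t} ?g"
          using continuous_on_subset[OF smooth_on_continuous_on[OF e(3)] sub] .
        then have "(?D has_integral (?g t - ?g s)) {s..t}"
          using D by (intro fundamental_theorem_of_calculus_interior s(2)) blast+
        then have hi: "((\<lambda>\<tau>. m *\<^sub>R ?D \<tau>) has_integral m *\<^sub>R (?g t - ?g s)) {s..t}"
          by (rule has_integral_cmul)
        have "norm (integral {s<..<t} (\<lambda>\<tau>. m *\<^sub>R ?D \<tau>)) \<le> integral {s<..<t} (speed M \<gamma>)"
        proof (rule Henstock_Kurzweil_Integration.integral_norm_bound_integral)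
          show "(\<lambda>\<tau>. m *\<^sub>R ?D \<tau>) integrable_on {s<..<t}"
            using has_integral_integrable[OF hi] unfolding integrable_on_open_interval_real .
          show "speed M \<gamma> integrable_on {s<..<t}"
            using int[OF s(1,3)] unfolding integrable_on_open_interval_real .
          show "norm (m *\<^sub>R ?D \<tau>) \<le> speed M \<gamma> \<tau>" if "\<tau> \<in> {s<..<t}" for \<tau> using D[OF that] by blast
        qed
        then have "norm (m *\<^sub>R (?g t - ?g s)) \<le> integral {s..t} (speed M \<gamma>)"
          unfolding integral_open_interval_real[symmetric] integral_unique[OF hi] .
        moreover have "\<bar>u (\<gamma> t) - u (\<gamma> s)\<bar> \<le> m * norm (snd c (\<gamma> t) - snd c (\<gamma> s))"
          using s by (intro u1 V1) auto
        ultimately show "\<bar>u (\<gamma> t) - u (\<gamma> s)\<bar> \<le> integral {s..t} (speed M \<gamma>)"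
          using m(1) by simp
      qed
      then show ?thesis using e(1) by blast
    next
      case False
      then have x2: "\<gamma> x \<in> V2" using V(3) xp by blast
      obtain d where d: "d \<in> atlas M" "\<gamma> x \<in> fst d" using in_some_chart[OF xp] by blast
      obtain e where e: "0 < e" "\<gamma> ` ({a..b} \<inter> ball x e) \<subseteq> V2 \<inter> fst d"
        by (rule smooth_curve_in_chart[OF \<gamma> xI d(1) openin_Int[OF V(2) chart_open[OF d(1)]] Int_lower2])
          (use x2 d(2) in auto)
      have "P s t" if st: "s \<le> x" "x \<le> t" "t - s < e" for s t
        unfolding P_def
      proof (intro impI)
        assume s: "a \<le> s" "s \<le> t" "t \<le> b"
        have "s \<in> {a..b} \<inter> ball x e" "t \<in> {a..b} \<inter> ball x e" using s st by (auto simp: dist_real_def)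
        then have "\<gamma> s \<in> V2" "\<gamma> t \<in> V2" using e(2) by blast+
        then have "u (\<gamma> t) = u (\<gamma> s)" by (intro u2)
        moreover have "0 \<le> integral {s..t} (speed M \<gamma>)"
          using s by (intro Henstock_Kurzweil_Integration.integral_nonneg int speed_nonneg
              smooth_curve_in_pts[OF \<gamma>]) auto
        ultimately show "\<bar>u (\<gamma> t) - u (\<gamma> s)\<bar> \<le> integral {s..t} (speed M \<gamma>)" by simp
      qed
      then show ?thesis using e(1) by blast
    qed
  qed
  then show ?thesis using ab by (simp add: P_def curve_length_def)
qed

text \<open>A curve from \<open>p\<close> to \<open>q\<close> must leave a small coordinate ball around \<open>p\<close>. The truncated coordinate distance from \<open>p\<close>
  makes this quantitative: it grows from \<open>0\<close> at \<open>p\<close> to its maximal value at \<open>q\<close>, and being constant outside the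
  ball it controls the whole curve without reference to a first exit time.\<close>

lemma joined_by_length_bounded_below:
  assumes p: "p \<in> pts M" and q: "q \<in> pts M" and "p \<noteq> q"
  obtains \<delta> where "0 < \<delta>" "\<And>L. joined_by_length M p q L \<Longrightarrow> \<delta> \<le> L"
proof -
  obtain c where c: "c \<in> atlas M" "p \<in> fst c" using in_some_chart[OF p] by blast
  obtain R where R: "0 < R" "half_space \<inter> cball (snd c p) R \<subseteq> snd c ` fst c"
    by (rule coordinate_ball[OF c])
  let ?K = "\<lambda>r. half_space \<inter> cball (snd c p) r"
  have K: "compact (?K r)" for r using half_space_closed_convex(1) by (simp add: closed_Int_compact)
  obtain m where m: "0 < m"
    "\<And>z v. z \<in> fst c \<Longrightarrow> snd c z \<in> ?K R \<Longrightarrow> m * norm v \<le> tangent_norm M c z v"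
    using tangent_norm_compact_bounds[OF c(1) K R(2)] by metis
  have hs: "snd c z \<in> half_space" if "z \<in> fst c" for z
    using is_chart_image_half_space[OF chart[OF c(1)]] that by blast
  obtain r where r: "0 < r" "r < R" and qr: "q \<in> fst c \<Longrightarrow> r < dist (snd c p) (snd c q)"
  proof (cases "q \<in> fst c")
    case True
    then have "snd c p \<noteq> snd c q"
      using \<open>p \<noteq> q\<close> c(2) is_chart_inj[OF chart[OF c(1)]] by (auto dest: inj_onD)
    then have "0 < min R (dist (snd c p) (snd c q))" using R(1) by simp
    then obtain r where "0 < r" "r < min R (dist (snd c p) (snd c q))" using dense by blast
    then show ?thesis using that by simp
  next
    case False
    then show ?thesis using that[of "R / 2"] R(1) by simp
  qed
  \<comment> \<open>The ball on which the tangent norm is controlled is strictly larger than the ball at which the distance is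
    truncated, so that \<open>V1\<close> and \<open>V2\<close> overlap and cover the manifold. Compactness of \<open>A\<close> makes \<open>V2\<close> open.\<close>
  define A where "A = {z \<in> fst c. snd c z \<in> ?K r}"
  define V1 where "V1 = {z \<in> fst c. snd c z \<in> ball (snd c p) R}"
  define V2 where "V2 = pts M - A"
  have "?K r \<subseteq> snd c ` fst c" using R(2) r(2) by (force simp: subset_iff)
  then have "compactin (mfd_topology M) A"
    unfolding A_def by (rule is_chart_compactin[OF chart[OF c(1)] K])
  then have "closedin (mfd_topology M) A" by (rule compactin_imp_closedin[OF Hausdorff])
  then have V2: "openin (mfd_topology M) V2" unfolding V2_def by (simp add: openin_diff)
  have V1: "openin (mfd_topology M) V1"
    unfolding V1_def by (rule is_chart_open_preimage[OF chart[OF c(1)] open_ball])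
  have V12: "pts M \<subseteq> V1 \<union> V2" using r(2) by (auto simp: V1_def V2_def A_def)
  have V1c: "V1 \<subseteq> fst c" by (auto simp: V1_def)
  have mV1: "m * norm v \<le> tangent_norm M c z v" if "z \<in> V1" for z v
    using that hs by (intro m(2)) (auto simp: V1_def)
  define u where "u z = (if z \<in> A then m * min r (dist (snd c p) (snd c z)) else m * r)" for z
  have u_V1: "u z = m * min r (dist (snd c p) (snd c z))" if "z \<in> V1" for z
    using that hs[of z] by (auto simp: u_def A_def V1_def)
  have u1: "\<bar>u y - u z\<bar> \<le> m * norm (snd c y - snd c z)" if "y \<in> V1" "z \<in> V1" for y z
  proof -
    have "\<bar>min r (dist (snd c p) (snd c y)) - min r (dist (snd c p) (snd c z))\<bar> \<le>
        \<bar>dist (snd c p) (snd c y) - dist (snd c p) (snd c z)\<bar>" by (simp add: min_def)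
    also have "\<dots> \<le> dist (snd c y) (snd c z)"
      using dist_triangle[of "snd c p" "snd c y" "snd c z"] dist_triangle[of "snd c p" "snd c z" "snd c y"]
      by (simp add: dist_commute abs_le_iff)
    finally have "m * \<bar>min r (dist (snd c p) (snd c y)) - min r (dist (snd c p) (snd c z))\<bar> \<le>
        m * norm (snd c y - snd c z)"
      using m(1) by (simp add: dist_norm)
    then show ?thesis
      using m(1) unfolding u_V1[OF that(1)] u_V1[OF that(2)] right_diff_distrib[symmetric] abs_mult by simp
  qed
  have u2: "u y = u z" if "y \<in> V2" "z \<in> V2" for y z using that by (simp add: u_def V2_def)
  have ge: "\<bar>u (\<gamma> b) - u (\<gamma> a)\<bar> \<le> curve_length M \<gamma> a b" if "piecewise_smooth_curve M \<gamma> a b" for \<gamma> a b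
    using that
  proof (induction rule: piecewise_smooth_curve.induct)
    case (smooth a b)
    show ?case
      by (rule smooth_curve_length_ge[OF smooth V1 V2 V12 c(1) V1c less_imp_le[OF m(1)] mV1 u1 u2])
  next
    case (join a c b)
    then show ?case using curve_length_join[OF join.hyps] by linarith
  qed
  have "q \<notin> A" using qr by (auto simp: A_def)
  then have uq: "u q = m * r" by (simp add: u_def)
  have "p \<in> V1" using c(2) R(1) by (simp add: V1_def)
  then have up: "u p = 0" using r(1) by (simp add: u_V1)
  show ?thesis
  proof (rule that)
    show "0 < m * r" using m(1) r(1) by simp
    fix L assume "joined_by_length M p q L"
    then show "m * r \<le> L" using ge uq up unfolding joined_by_length_def by fastforce
  qed
qed

end

locale connected_riemannian = riemannian M for M :: "('a, 'e::euclidean_space) riem" +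
  assumes connected: "connected_space (mfd_topology M)"
begin

lemma lengths_nonempty:
  "p \<in> pts M \<Longrightarrow> q \<in> pts M \<Longrightarrow> Collect (joined_by_length M p q) \<noteq> {}"
  using connected_imp_joined_by_length[OF connected] by blast

lemma rdist_le: "joined_by_length M p q L \<Longrightarrow> rdist M p q \<le> L"
  unfolding rdist_eq
  by (rule cInf_lower) (auto intro!: bdd_belowI[of _ 0] joined_by_length_nonneg)

lemma rdist_greatest:
  assumes "p \<in> pts M" "q \<in> pts M" "\<And>L. joined_by_length M p q L \<Longrightarrow> x \<le> L"
  shows "x \<le> rdist M p q"
  unfolding rdist_eq using lengths_nonempty[OF assms(1,2)] assms(3) by (intro cInf_greatest) auto

lemma rdist_nonneg: "p \<in> pts M \<Longrightarrow> q \<in> pts M \<Longrightarrow> 0 \<le> rdist M p q"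
  by (rule rdist_greatest) (auto intro: joined_by_length_nonneg)

lemma rdist_commute: "rdist M p q = rdist M q p"
proof -
  have "joined_by_length M p q = joined_by_length M q p" using joined_by_length_sym by blast
  then show ?thesis by (simp add: rdist_eq)
qed

lemma rdist_triangle:
  assumes "p \<in> pts M" "q \<in> pts M" "r \<in> pts M"
  shows "rdist M p r \<le> rdist M p q + rdist M q r"
proof -
  have "rdist M p r - rdist M q r \<le> rdist M p q"
  proof (rule rdist_greatest[OF assms(1,2)])
    fix L assume L: "joined_by_length M p q L"
    have "rdist M p r - L \<le> rdist M q r"
    proof (rule rdist_greatest[OF assms(2,3)])
      fix L' assume "joined_by_length M q r L'"
      then have "rdist M p r \<le> L + L'" by (intro rdist_le joined_by_length_trans[OF L])
      then show "rdist M p r - L \<le> L'" by simp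
    qed
    then show "rdist M p r - rdist M q r \<le> L" by simp
  qed
  then show ?thesis by simp
qed

lemma rdist_refl: "p \<in> pts M \<Longrightarrow> rdist M p p = 0"
  using rdist_le[OF joined_by_length_refl] rdist_nonneg by (simp add: order_antisym)

lemma rdist_eq_0_iff:
  assumes "p \<in> pts M" "q \<in> pts M"
  shows "rdist M p q = 0 \<longleftrightarrow> p = q"
proof
  assume 0: "rdist M p q = 0"
  show "p = q"
  proof (rule ccontr)
    assume "p \<noteq> q"
    then obtain \<delta> where \<delta>: "0 < \<delta>" "\<And>L. joined_by_length M p q L \<Longrightarrow> \<delta> \<le> L"
      using joined_by_length_bounded_below[OF assms] by metis
    then have "\<delta> \<le> rdist M p q" by (intro rdist_greatest[OF assms])
    with 0 \<delta>(1) show False by simp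
  qed
qed (simp add: rdist_refl assms)

text \<open>Finitely many of the neighborhoods from \<open>locally_joined_by_length\<close> cover the manifold, and their
  centers lie at finite distance from a base point.\<close>

lemma compact_imp_rdist_bounded:
  assumes "compact_space (mfd_topology M)"
  obtains D where "\<And>p q. p \<in> pts M \<Longrightarrow> q \<in> pts M \<Longrightarrow> rdist M p q \<le> D"
proof -
  obtain p0 where p0: "p0 \<in> pts M" using pts_nonempty by blast
  have "\<exists>V B. openin (mfd_topology M) V \<and> p \<in> V \<and> (\<forall>q\<in>V. rdist M p q \<le> B)" if p: "p \<in> pts M" for p
  proof -
    obtain V B where V: "openin (mfd_topology M) V" "p \<in> V"
      and B: "\<forall>q\<in>V. \<exists>L\<le>B. joined_by_length M p q L"
      by (rule locally_joined_by_length[OF p])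
    have "rdist M p q \<le> B" if "q \<in> V" for q using bspec[OF B that] rdist_le order_trans by blast
    with V show ?thesis by blast
  qed
  then obtain V B where V: "\<And>p. p \<in> pts M \<Longrightarrow> openin (mfd_topology M) (V p)" "\<And>p. p \<in> pts M \<Longrightarrow> p \<in> V p"
    and B: "\<And>p q. p \<in> pts M \<Longrightarrow> q \<in> V p \<Longrightarrow> rdist M p q \<le> B p"
    by metis
  have "(\<forall>U\<in>V ` pts M. openin (mfd_topology M) U) \<and> pts M \<subseteq> \<Union> (V ` pts M)"
    using V by blast
  then obtain \<F> where "finite \<F>" "\<F> \<subseteq> V ` pts M" "pts M \<subseteq> \<Union> \<F>"
    using spec[OF assms[unfolded compact_space_alt], of "V ` pts M"] by blast
  then obtain F where F: "finite F" "F \<subseteq> pts M" "pts M \<subseteq> (\<Union>p\<in>F. V p)"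
    using finite_subset_image[of \<F> V "pts M"] by blast
  \<comment> \<open>A sum of absolute values in place of a maximum, which would require the cover to be nonempty.\<close>
  define E where "E = (\<Sum>p\<in>F. \<bar>rdist M p0 p + B p\<bar>)"
  have E: "rdist M p0 q \<le> E" if q: "q \<in> pts M" for q
  proof -
    obtain p where p: "p \<in> F" "q \<in> V p" using F(3) q by blast
    have "rdist M p0 q \<le> rdist M p0 p + rdist M p q"
      using F(2) p(1) by (intro rdist_triangle p0 q) auto
    also have "\<dots> \<le> \<bar>rdist M p0 p + B p\<bar>" using B[of p q] p F(2) by force
    also have "\<dots> \<le> E" unfolding E_def by (rule member_le_sum[OF p(1) _ F(1)]) simp
    finally show ?thesis .
  qed
  show ?thesis
  proof (rule that)
    fix p q assume pq: "p \<in> pts M" "q \<in> pts M"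
    then show "rdist M p q \<le> E + E"
      using rdist_triangle[OF pq(1) p0 pq(2)] E[OF pq(1)] E[OF pq(2)] rdist_commute[of p p0] by linarith
  qed
qed

end

section \<open>Riemannian isometric embeddings\<close>

locale compact_riem_embedding = M: connected_riemannian M + N: connected_riemannian N
  for M :: "('a, 'e::euclidean_space) riem" and N :: "('c, 'f::euclidean_space) riem" +
  fixes f :: "'a \<Rightarrow> 'c"
  assumes compact: "compact_space (mfd_topology M)"
    and isometric: "riem_isometric_embedding M N f"
begin

lemma smooth_map: "smooth_map_on M (pts M) N f"
  using isometric unfolding riem_isometric_embedding_def diffeo_onto_image_def by blast

lemma image_pts: "p \<in> pts M \<Longrightarrow> f p \<in> pts N"
  using smooth_map unfolding smooth_map_on_def by blast

lemma smooth_in_charts: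
  assumes "p \<in> pts M"
  obtains c d W where "c \<in> atlas M" "d \<in> atlas N" "openin (mfd_topology M) W" "p \<in> W" "W \<subseteq> fst c"
    "f ` W \<subseteq> fst d" "smooth_on (snd c ` W) (snd d \<circ> f \<circ> chart_inv c)"
proof -
  have "\<forall>p\<in>pts M. \<exists>c\<in>atlas M. \<exists>d\<in>atlas N. \<exists>W. openin (mfd_topology M) W \<and> p \<in> W \<and> W \<subseteq> fst c \<and>
      f ` (pts M \<inter> W) \<subseteq> fst d \<and> smooth_on (snd c ` (pts M \<inter> W)) (snd d \<circ> f \<circ> chart_inv c)"
    using smooth_map unfolding smooth_map_on_def by (elim conjE)
  from bspec[OF this assms] obtain c d W
    where cd: "c \<in> atlas M" "d \<in> atlas N" and W: "openin (mfd_topology M) W" "p \<in> W" "W \<subseteq> fst c"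
      and f: "f ` (pts M \<inter> W) \<subseteq> fst d" "smooth_on (snd c ` (pts M \<inter> W)) (snd d \<circ> f \<circ> chart_inv c)"
    by (elim bexE exE conjE)
  have "pts M \<inter> W = W" using openin_subset[OF W(1)] by blast
  then show ?thesis using that[OF cd W] f by simp
qed

text \<open>By the chain rule the velocity of the image curve is the coordinate differential applied to the
  velocity of the curve, and this linear map preserves tangent norms.\<close>

lemma smooth_curve_image:
  assumes \<gamma>: "smooth_curve M \<gamma> a b"
  shows "smooth_curve N (f \<circ> \<gamma>) a b"
    and "\<And>t. t \<in> {a<..<b} \<Longrightarrow> speed N (f \<circ> \<gamma>) t = speed M \<gamma> t"
proof -
  have local: "\<exists>c\<in>atlas M. \<exists>d\<in>atlas N. \<exists>W e. openin (mfd_topology M) W \<and> W \<subseteq> fst c \<and> f ` W \<subseteq> fst d \<and>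
      smooth_on (snd c ` W) (snd d \<circ> f \<circ> chart_inv c) \<and> 0 < e \<and>
      \<gamma> ` ({a..b} \<inter> ball t e) \<subseteq> W \<and> smooth_on ({a..b} \<inter> ball t e) (snd c \<circ> \<gamma>)"
    if t: "t \<in> {a..b}" for t
  proof -
    obtain c d W where cd: "c \<in> atlas M" "d \<in> atlas N"
      and W: "openin (mfd_topology M) W" "\<gamma> t \<in> W" "W \<subseteq> fst c"
      and f: "f ` W \<subseteq> fst d" "smooth_on (snd c ` W) (snd d \<circ> f \<circ> chart_inv c)"
      by (rule smooth_in_charts[OF M.smooth_curve_in_pts[OF \<gamma> t]])
    obtain e where e: "0 < e" "\<gamma> ` ({a..b} \<inter> ball t e) \<subseteq> W" "smooth_on ({a..b} \<inter> ball t e) (snd c \<circ> \<gamma>)"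
      by (rule M.smooth_curve_in_chart[OF \<gamma> t cd(1) W(1,3,2)])
    show ?thesis using cd W f e by blast
  qed
  show "smooth_curve N (f \<circ> \<gamma>) a b"
    unfolding smooth_curve_def
  proof (intro conjI ballI)
    show "a < b" using \<gamma> by (simp add: smooth_curve_def)
    fix t assume t: "t \<in> {a..b}"
    obtain c d W e where cd: "c \<in> atlas M" "d \<in> atlas N"
      and W: "openin (mfd_topology M) W" "W \<subseteq> fst c"
      and f: "f ` W \<subseteq> fst d" "smooth_on (snd c ` W) (snd d \<circ> f \<circ> chart_inv c)"
      and e: "0 < e" "\<gamma> ` ({a..b} \<inter> ball t e) \<subseteq> W" "smooth_on ({a..b} \<inter> ball t e) (snd c \<circ> \<gamma>)"
      using local[OF t] by (elim bexE exE conjE)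
    let ?J = "{a..b} \<inter> ball t e"
    have "(snd c \<circ> \<gamma>) ` ?J \<subseteq> snd c ` W" using e(2) by auto
    with e(3) f(2) have "smooth_on ?J (\<lambda>s. (snd d \<circ> f \<circ> chart_inv c) ((snd c \<circ> \<gamma>) s))"
      by (rule smooth_on_compose)
    then have "smooth_on ?J (snd d \<circ> (f \<circ> \<gamma>))"
    proof (rule smooth_on_cong)
      fix s assume "s \<in> ?J"
      then have "\<gamma> s \<in> fst c" using e(2) W(2) by blast
      then show "(snd d \<circ> f \<circ> chart_inv c) ((snd c \<circ> \<gamma>) s) = (snd d \<circ> (f \<circ> \<gamma>)) s"
        using chart_inv_eq[OF M.chart[OF cd(1)]] by simp
    qed
    moreover have "(f \<circ> \<gamma>) ` ?J \<subseteq> fst d" using e(2) f(1) by auto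
    ultimately show "\<exists>c\<in>atlas N. \<exists>\<epsilon>>0. (f \<circ> \<gamma>) ` ({a..b} \<inter> ball t \<epsilon>) \<subseteq> fst c \<and>
        smooth_on ({a..b} \<inter> ball t \<epsilon>) (snd c \<circ> (f \<circ> \<gamma>))"
      using cd(2) e(1) by blast
  qed
  fix t assume t: "t \<in> {a<..<b}"
  then have t': "t \<in> {a..b}" by simp
  obtain c d W e where cd: "c \<in> atlas M" "d \<in> atlas N"
    and W: "openin (mfd_topology M) W" "W \<subseteq> fst c"
    and f: "f ` W \<subseteq> fst d" "smooth_on (snd c ` W) (snd d \<circ> f \<circ> chart_inv c)"
    and e: "0 < e" "\<gamma> ` ({a..b} \<inter> ball t e) \<subseteq> W"
    using local[OF t'] by (elim bexE exE conjE)
  let ?T = "{a<..<b} \<inter> ball t e"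
  have T: "open ?T" "t \<in> ?T" using t e(1) by auto
  have TW: "\<gamma> ` ?T \<subseteq> W" using e(2) by (fastforce simp: image_subset_iff)
  then have tW: "\<gamma> t \<in> W" using T(2) by blast
  then have tc: "\<gamma> t \<in> fst c" "f (\<gamma> t) \<in> fst d" using W(2) f(1) by blast+
  have ab: "a < t" "t < b" using t by auto
  obtain v where v: "((snd c \<circ> \<gamma>) has_vector_derivative v) (at t)" "speed M \<gamma> t = tangent_norm M c (\<gamma> t) v"
    by (rule M.smooth_curve_speed[OF \<gamma> ab cd(1) tc(1)])
  have "((snd d \<circ> f \<circ> \<gamma>) has_vector_derivative coord_differential c d f (\<gamma> t) v) (at t)"
    by (rule coord_differential_curve[OF M.chart[OF cd(1)] W f T TW v(1)])
  then have "((snd d \<circ> (f \<circ> \<gamma>)) has_vector_derivative coord_differential c d f (\<gamma> t) v) (at t)"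
    by (simp only: o_assoc)
  moreover have "(f \<circ> \<gamma>) ` ?T \<subseteq> fst d" using TW f(1) by auto
  ultimately have "speed N (f \<circ> \<gamma>) t = tangent_norm N d ((f \<circ> \<gamma>) t) (coord_differential c d f (\<gamma> t) v)"
    by (intro N.speed_eq[OF cd(2) T])
  also have "\<dots> = tangent_norm M c (\<gamma> t) v"
    using isometric cd tc unfolding riem_isometric_embedding_def by simp
  finally show "speed N (f \<circ> \<gamma>) t = speed M \<gamma> t" using v(2) by simp
qed

lemma piecewise_smooth_curve_image:
  "piecewise_smooth_curve M \<gamma> a b \<Longrightarrow>
    piecewise_smooth_curve N (f \<circ> \<gamma>) a b \<and> curve_length N (f \<circ> \<gamma>) a b = curve_length M \<gamma> a b"
proof (induction rule: piecewise_smooth_curve.induct)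
  case (smooth a b)
  have "curve_length N (f \<circ> \<gamma>) a b = curve_length M \<gamma> a b"
    unfolding curve_length_def integral_open_interval_real
    by (rule Henstock_Kurzweil_Integration.integral_cong) (rule smooth_curve_image(2)[OF smooth])
  with piecewise_smooth_curve.smooth[OF smooth_curve_image(1)[OF smooth]] show ?case by blast
next
  case (join a c b)
  then have N: "piecewise_smooth_curve N (f \<circ> \<gamma>) a c" "piecewise_smooth_curve N (f \<circ> \<gamma>) c b" by blast+
  have "curve_length N (f \<circ> \<gamma>) a b = curve_length M \<gamma> a b"
    using N.curve_length_join[OF N] M.curve_length_join[OF join.hyps] join.IH by simp
  with piecewise_smooth_curve.join[OF N] show ?case by blast
qed

text \<open>Every curve between \<open>p\<close> and \<open>q\<close> has an image of the same length that competes for the distance in \<open>N\<close>.\<close>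

lemma rdist_image_le:
  assumes "p \<in> pts M" "q \<in> pts M"
  shows "rdist N (f p) (f q) \<le> rdist M p q"
proof (rule M.rdist_greatest[OF assms])
  fix L assume "joined_by_length M p q L"
  then obtain \<gamma> a b where "piecewise_smooth_curve M \<gamma> a b" "\<gamma> a = p" "\<gamma> b = q" "curve_length M \<gamma> a b = L"
    unfolding joined_by_length_def by blast
  then have "joined_by_length N (f p) (f q) L"
    using piecewise_smooth_curve_image[of \<gamma> a b] joined_by_lengthI[of N "f \<circ> \<gamma>" a b] by auto
  then show "rdist N (f p) (f q) \<le> L" by (rule N.rdist_le)
qed

text \<open>The supremum that defines the embedding constant is over a bounded set, by finiteness of the diameter.\<close>

lemma rdist_le_embedding_constant:
  assumes "p \<in> pts M" "q \<in> pts M"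
  shows "rdist M p q \<le> rdist N (f p) (f q) + embedding_constant M N f"
proof -
  obtain D where D: "\<And>p q. p \<in> pts M \<Longrightarrow> q \<in> pts M \<Longrightarrow> rdist M p q \<le> D"
    using M.compact_imp_rdist_bounded[OF compact] by blast
  let ?g = "\<lambda>(p, q). rdist M p q - rdist N (f p) (f q)"
  have "?g z \<le> D" if z: "z \<in> pts M \<times> pts M" for z
  proof -
    obtain x y where "z = (x, y)" "x \<in> pts M" "y \<in> pts M" using z by blast
    then show ?thesis using D[of x y] N.rdist_nonneg[of "f x" "f y"] image_pts by simp
  qed
  then have "bdd_above (?g ` (pts M \<times> pts M))" by (intro bdd_aboveI2)
  moreover have "(p, q) \<in> pts M \<times> pts M" using assms by simp
  ultimately have "?g (p, q) \<le> embedding_constant M N f"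
    unfolding embedding_constant_def by (intro cSUP_upper)
  then show ?thesis by simp
qed

lemma embedding_constant_nonneg: "0 \<le> embedding_constant M N f"
proof -
  obtain p where p: "p \<in> pts M" using M.pts_nonempty by blast
  show ?thesis
    using rdist_le_embedding_constant[OF p p] M.rdist_refl[OF p] N.rdist_refl[OF image_pts[OF p]] by simp
qed

lemma rdiam_nonneg: "0 \<le> rdiam M"
proof -
  obtain D where D: "\<And>p q. p \<in> pts M \<Longrightarrow> q \<in> pts M \<Longrightarrow> rdist M p q \<le> D"
    using M.compact_imp_rdist_bounded[OF compact] by blast
  obtain p where p: "p \<in> pts M" using M.pts_nonempty by blast
  let ?g = "\<lambda>(p, q). rdist M p q"
  have "bdd_above (?g ` (pts M \<times> pts M))" using D by (intro bdd_aboveI2[of _ _ D]) auto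
  then have "?g (p, p) \<le> rdiam M"
    unfolding rdiam_def using p by (intro cSUP_upper) auto
  then show ?thesis using M.rdist_refl[OF p] by simp
qed

text \<open>Here \<open>S = sqrt (C * (diam + C)) \<ge> sqrt (C * C) = C\<close>, because \<open>C\<close> and the diameter are nonnegative.\<close>

lemma embedding_constant_le_separation: "embedding_constant M N f \<le> separation M N f"
  unfolding separation_def
  using embedding_constant_nonneg rdiam_nonneg
  by (intro real_le_rsqrt) (simp add: power2_eq_square mult_left_mono)

end

section \<open>Hausdorff and Gromov--Hausdorff distances\<close>

lemma hausdorff_dist_le:
  "0 < \<rho> \<Longrightarrow> X1 \<subseteq> tube Z d \<rho> X2 \<Longrightarrow> X2 \<subseteq> tube Z d \<rho> X1 \<Longrightarrow> hausdorff_dist Z d X1 X2 \<le> \<rho>"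
  unfolding hausdorff_dist_def by (rule cInf_lower) (auto intro!: bdd_belowI[of _ 0])

text \<open>Boundedness of both sets provides an admissible radius; hence the infimum that defines the
  Hausdorff distance is not taken over the empty set.\<close>

lemma tube_radius_exists:
  fixes d :: "'z \<Rightarrow> 'z \<Rightarrow> real"
  assumes tri: "\<And>x y z. x \<in> Z \<Longrightarrow> y \<in> Z \<Longrightarrow> z \<in> Z \<Longrightarrow> d x z \<le> d x y + d y z"
    and X: "X1 \<subseteq> Z" "X1 \<noteq> {}" "\<And>x x'. x \<in> X1 \<Longrightarrow> x' \<in> X1 \<Longrightarrow> d x x' \<le> D1"
    and Y: "X2 \<subseteq> Z" "X2 \<noteq> {}" "\<And>y y'. y \<in> X2 \<Longrightarrow> y' \<in> X2 \<Longrightarrow> d y y' \<le> D2"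
  shows "\<exists>\<rho>. 0 < \<rho> \<and> X1 \<subseteq> tube Z d \<rho> X2 \<and> X2 \<subseteq> tube Z d \<rho> X1"
proof -
  obtain x0 y0 where 0: "x0 \<in> X1" "y0 \<in> X2" using X Y by blast
  have 0: "x0 \<in> X1" "y0 \<in> X2" "x0 \<in> Z" "y0 \<in> Z" using 0 X Y by blast+
  define \<rho> where "\<rho> = \<bar>D1\<bar> + \<bar>D2\<bar> + \<bar>d x0 y0\<bar> + \<bar>d y0 x0\<bar> + 1"
  have "d y0 x < \<rho>" if "x \<in> X1" for x
  proof -
    have "x \<in> Z" using that X(1) by blast
    then show ?thesis using tri[of y0 x0 x] X(3)[of x0 x] 0 that unfolding \<rho>_def by linarith
  qed
  moreover have "d x0 y < \<rho>" if "y \<in> X2" for y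
  proof -
    have "y \<in> Z" using that Y(1) by blast
    then show ?thesis using tri[of x0 y0 y] Y(3)[of y0 y] 0 that unfolding \<rho>_def by linarith
  qed
  moreover have "0 < \<rho>" unfolding \<rho>_def by linarith
  ultimately show ?thesis using 0 X(1) Y(1) unfolding tube_def by (intro exI[of _ \<rho>]) blast
qed

text \<open>The infimum over all joint embeddings is a lower bound only because the competing Hausdorff distances are
  nonnegative, which rests on the existence of an admissible radius for each of them.\<close>

lemma gh_dist_le_hausdorff_dist:
  fixes X :: "'a set" and Y :: "'b set" and Z :: "('a + 'b) set"
  assumes X: "X \<noteq> {}" "\<And>x x'. x \<in> X \<Longrightarrow> x' \<in> X \<Longrightarrow> dX x x' \<le> D1"
    and Y: "Y \<noteq> {}" "\<And>y y'. y \<in> Y \<Longrightarrow> y' \<in> Y \<Longrightarrow> dY y y' \<le> D2"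
    and Z: "Metric_space Z d" "dist_preserving X dX Z d \<psi>1" "dist_preserving Y dY Z d \<psi>2"
  shows "gh_dist X dX Y dY \<le> hausdorff_dist Z d (\<psi>1 ` X) (\<psi>2 ` Y)"
proof -
  have "0 \<le> h" if "h \<in> joint_hausdorff_dists X dX Y dY TYPE('a + 'b)" for h
  proof -
    obtain Z :: "('a + 'b) set" and d \<psi>1 \<psi>2 where
      h: "h = hausdorff_dist Z d (\<psi>1 ` X) (\<psi>2 ` Y)" and ms: "Metric_space Z d"
      and 1: "dist_preserving X dX Z d \<psi>1" and 2: "dist_preserving Y dY Z d \<psi>2"
      using \<open>h \<in> _\<close> unfolding joint_hausdorff_dists_def by blast
    have "\<exists>\<rho>. 0 < \<rho> \<and> \<psi>1 ` X \<subseteq> tube Z d \<rho> (\<psi>2 ` Y) \<and> \<psi>2 ` Y \<subseteq> tube Z d \<rho> (\<psi>1 ` X)"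
    proof (rule tube_radius_exists)
      show "d x z \<le> d x y + d y z" if "x \<in> Z" "y \<in> Z" "z \<in> Z" for x y z
        using Metric_space.triangle[OF ms that] .
      show "d x x' \<le> D1" if "x \<in> \<psi>1 ` X" "x' \<in> \<psi>1 ` X" for x x'
        using that 1 X(2) unfolding dist_preserving_def by force
      show "d y y' \<le> D2" if "y \<in> \<psi>2 ` Y" "y' \<in> \<psi>2 ` Y" for y y'
        using that 2 Y(2) unfolding dist_preserving_def by force
    qed (use 1 2 X(1) Y(1) in \<open>auto simp: dist_preserving_def\<close>)
    then show "0 \<le> h"
      unfolding h hausdorff_dist_def by (intro cInf_greatest) auto
  qed
  then have "bdd_below (joint_hausdorff_dists X dX Y dY TYPE('a + 'b))" by (intro bdd_belowI[of _ 0])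
  moreover have "hausdorff_dist Z d (\<psi>1 ` X) (\<psi>2 ` Y) \<in> joint_hausdorff_dists X dX Y dY TYPE('a + 'b)"
    unfolding joint_hausdorff_dists_def using Z by blast
  ultimately show ?thesis unfolding gh_dist_def by (intro cInf_lower)
qed

text \<open>A distance may be redefined off the space. This matters because \<^locale>\<open>Metric_space\<close> asks for
  nonnegativity and symmetry on the whole type.\<close>

lemma gh_dist_cong:
  fixes X :: "'a set" and Y :: "'b set"
  assumes "\<And>x x'. x \<in> X \<Longrightarrow> x' \<in> X \<Longrightarrow> dX x x' = dX' x x'"
    and "\<And>y y'. y \<in> Y \<Longrightarrow> y' \<in> Y \<Longrightarrow> dY y y' = dY' y y'"
  shows "gh_dist X dX Y dY = gh_dist X dX' Y dY'"
proof -
  have "dist_preserving X dX (Z :: ('a + 'b) set) = dist_preserving X dX' Z" for Z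
    using assms(1) by (intro ext) (simp add: dist_preserving_def)
  moreover have "dist_preserving Y dY (Z :: ('a + 'b) set) = dist_preserving Y dY' Z" for Z
    using assms(2) by (intro ext) (simp add: dist_preserving_def)
  ultimately show ?thesis unfolding gh_dist_def joint_hausdorff_dists_def by simp
qed

text \<open>A correspondence of distortion at most \<open>2 * \<kappa>\<close> gives a metric on the disjoint union in which
  corresponding points lie at distance \<open>\<kappa>\<close>. A passage between the two parts costs \<open>\<kappa>\<close> and
  is possible only at corresponding points. Two passages cost \<open>2 * \<kappa>\<close>, so the distortion
  bound is exactly what prevents shortcuts through the other part.\<close>

lemma gh_dist_le_correspondence:
  fixes dX :: "'a \<Rightarrow> 'a \<Rightarrow> real" and dY :: "'b \<Rightarrow> 'b \<Rightarrow> real"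
  assumes X: "Metric_space X dX" "X \<noteq> {}" "\<And>x x'. x \<in> X \<Longrightarrow> x' \<in> X \<Longrightarrow> dX x x' \<le> D1"
    and Y: "Metric_space Y dY" "Y \<noteq> {}" "\<And>y y'. y \<in> Y \<Longrightarrow> y' \<in> Y \<Longrightarrow> dY y y' \<le> D2"
    and R: "R \<subseteq> X \<times> Y" "\<And>x. x \<in> X \<Longrightarrow> \<exists>y. (x, y) \<in> R" "\<And>y. y \<in> Y \<Longrightarrow> \<exists>x. (x, y) \<in> R"
    and dis: "\<And>x y x' y'. (x, y) \<in> R \<Longrightarrow> (x', y') \<in> R \<Longrightarrow> \<bar>dX x x' - dY y y'\<bar> \<le> 2 * \<kappa>"
    and \<kappa>: "0 < \<kappa>"
  shows "gh_dist X dX Y dY \<le> \<kappa>"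
proof -
  interpret X: Metric_space X dX by (fact X)
  interpret Y: Metric_space Y dY by (fact Y)
  define e where "e x y = (INF (a, b)\<in>R. dX x a + \<kappa> + dY b y)" for x y
  have R_ne: "R \<noteq> {}" using X(2) R(2) by blast
  have bdd: "bdd_below ((\<lambda>(a, b). dX x a + \<kappa> + dY b y) ` R)" for x y
    using \<kappa> by (intro bdd_belowI2[of _ 0]) auto
  have e_le: "e x y \<le> dX x a + \<kappa> + dY b y" if "(a, b) \<in> R" for x y a b
    using cINF_lower[OF bdd that] by (simp add: e_def)
  have e_ge: "z \<le> e x y" if "\<And>a b. (a, b) \<in> R \<Longrightarrow> z \<le> dX x a + \<kappa> + dY b y" for x y z
    unfolding e_def using that by (intro cINF_greatest[OF R_ne]) auto
  have RX: "a \<in> X" and RY: "b \<in> Y" if "(a, b) \<in> R" for a b using that R(1) by auto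
  have e_pos: "0 < e x y" for x y
  proof -
    have "\<kappa> \<le> e x y" by (rule e_ge) simp
    then show ?thesis using \<kappa> by simp
  qed
  have tri1: "e x y \<le> dX x x' + e x' y" if x: "x \<in> X" "x' \<in> X" for x x' y
  proof -
    have "e x y - dX x x' \<le> e x' y"
    proof (rule e_ge)
      fix a b assume ab: "(a, b) \<in> R"
      show "e x y - dX x x' \<le> dX x' a + \<kappa> + dY b y"
        using e_le[OF ab, of x y] X.triangle[OF x RX[OF ab]] by linarith
    qed
    then show ?thesis by simp
  qed
  have tri2: "e x y \<le> e x y' + dY y' y" if y: "y \<in> Y" "y' \<in> Y" for x y y'
  proof -
    have "e x y - dY y' y \<le> e x y'"
    proof (rule e_ge)
      fix a b assume ab: "(a, b) \<in> R"
      show "e x y - dY y' y \<le> dX x a + \<kappa> + dY b y'"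
        using e_le[OF ab, of x y] Y.triangle[OF RY[OF ab] y(2,1)] by linarith
    qed
    then show ?thesis by simp
  qed
  have tri3: "dX x x' \<le> e x y + e x' y" if x: "x \<in> X" "x' \<in> X" and y: "y \<in> Y" for x x' y
  proof -
    have "dX x x' - e x' y \<le> e x y"
    proof (rule e_ge)
      fix a b assume ab: "(a, b) \<in> R"
      have "dX x x' - (dX x a + \<kappa> + dY b y) \<le> e x' y"
      proof (rule e_ge)
        fix a' b' assume ab': "(a', b') \<in> R"
        show "dX x x' - (dX x a + \<kappa> + dY b y) \<le> dX x' a' + \<kappa> + dY b' y"
          using X.triangle[OF x(1) RX[OF ab] x(2)] X.triangle[OF RX[OF ab] RX[OF ab'] x(2)]
            Y.triangle[OF RY[OF ab] y RY[OF ab']] dis[OF ab ab']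
            X.commute[of a' x'] Y.commute[of y b'] by linarith
      qed
      then show "dX x x' - e x' y \<le> dX x a + \<kappa> + dY b y" by simp
    qed
    then show ?thesis by simp
  qed
  have tri4: "dY y y' \<le> e x y + e x y'" if y: "y \<in> Y" "y' \<in> Y" and x: "x \<in> X" for x y y'
  proof -
    have "dY y y' - e x y' \<le> e x y"
    proof (rule e_ge)
      fix a b assume ab: "(a, b) \<in> R"
      have "dY y y' - (dX x a + \<kappa> + dY b y) \<le> e x y'"
      proof (rule e_ge)
        fix a' b' assume ab': "(a', b') \<in> R"
        show "dY y y' - (dX x a + \<kappa> + dY b y) \<le> dX x a' + \<kappa> + dY b' y'"
          using Y.triangle[OF y(1) RY[OF ab] y(2)] Y.triangle[OF RY[OF ab] RY[OF ab'] y(2)]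
            X.triangle[OF RX[OF ab] x RX[OF ab']] dis[OF ab ab']
            Y.commute[of y b] X.commute[of a x] by linarith
      qed
      then show "dY y y' - e x y' \<le> dX x a + \<kappa> + dY b y" by simp
    qed
    then show ?thesis by simp
  qed
  define d where "d s t = (case s of
      Inl x \<Rightarrow> (case t of Inl x' \<Rightarrow> dX x x' | Inr y \<Rightarrow> e x y)
    | Inr y \<Rightarrow> (case t of Inl x \<Rightarrow> e x y | Inr y' \<Rightarrow> dY y y'))" for s t :: "'a + 'b"
  have d_simps: "d (Inl x) (Inl x') = dX x x'" "d (Inl x) (Inr y) = e x y"
    "d (Inr y) (Inl x) = e x y" "d (Inr y) (Inr y') = dY y y'" for x x' y y'
    by (simp_all add: d_def)
  let ?Z = "Inl ` X \<union> Inr ` Y :: ('a + 'b) set"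
  have Z: "Metric_space ?Z d"
  proof
    fix s t :: "'a + 'b"
    show "0 \<le> d s t" using e_pos by (cases s; cases t) (auto simp: d_simps less_imp_le)
    show "d s t = d t s" by (cases s; cases t) (auto simp: d_simps X.commute Y.commute)
    show "d s t = 0 \<longleftrightarrow> s = t" if "s \<in> ?Z" "t \<in> ?Z"
      using that e_pos by (cases s; cases t) (auto simp: d_simps less_imp_neq[symmetric])
  next
    have tri1': "e x y \<le> e x' y + dX x' x" if "x \<in> X" "x' \<in> X" for x x' y
      using tri1[OF that, of y] X.commute[of x x'] by linarith
    have tri2': "e x y \<le> dY y y' + e x y'" if "y \<in> Y" "y' \<in> Y" for x y y'
      using tri2[OF that, of x] Y.commute[of y y'] by linarith
    fix s t u :: "'a + 'b" assume stu: "s \<in> ?Z" "t \<in> ?Z" "u \<in> ?Z"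
    have mem: "Inl x \<in> ?Z \<longleftrightarrow> x \<in> X" "Inr y \<in> ?Z \<longleftrightarrow> y \<in> Y" for x y by auto
    show "d s u \<le> d s t + d t u"
      using stu
      by (cases s; cases t; cases u; hypsubst; unfold mem d_simps)
        (rule X.triangle Y.triangle tri1 tri1' tri2 tri2' tri3 tri4; assumption)+
  qed
  have "gh_dist X dX Y dY \<le> hausdorff_dist ?Z d (Inl ` X) (Inr ` Y)"
    by (rule gh_dist_le_hausdorff_dist[OF X(2,3) Y(2,3) Z]) (auto simp: dist_preserving_def d_simps)
  also have "\<dots> \<le> \<kappa>"
  proof (rule dense_ge)
    fix \<rho> assume \<rho>: "\<kappa> < \<rho>"
    have e_R: "e x y < \<rho>" if "(x, y) \<in> R" for x y
      using e_le[OF that, of x y] RX[OF that] RY[OF that] \<rho> by simp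
    show "hausdorff_dist ?Z d (Inl ` X) (Inr ` Y) \<le> \<rho>"
    proof (rule hausdorff_dist_le)
      show "0 < \<rho>" using \<kappa> \<rho> by simp
      show "Inl ` X \<subseteq> tube ?Z d \<rho> (Inr ` Y)"
      proof
        fix s :: "'a + 'b" assume "s \<in> Inl ` X"
        then obtain x where s: "s = Inl x" "x \<in> X" by blast
        then obtain y where "(x, y) \<in> R" using R(2) by blast
        then have "y \<in> Y" "d (Inr y) s < \<rho>" using RY e_R s by (auto simp: d_simps)
        then show "s \<in> tube ?Z d \<rho> (Inr ` Y)" using s unfolding tube_def by blast
      qed
      show "Inr ` Y \<subseteq> tube ?Z d \<rho> (Inl ` X)"
      proof
        fix s :: "'a + 'b" assume "s \<in> Inr ` Y"
        then obtain y where s: "s = Inr y" "y \<in> Y" by blast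
        then obtain x where "(x, y) \<in> R" using R(3) by blast
        then have "x \<in> X" "d (Inl x) s < \<rho>" using RX e_R s by (auto simp: d_simps)
        then show "s \<in> tube ?Z d \<rho> (Inl ` X)" using s unfolding tube_def by blast
      qed
    qed
  qed
  finally show ?thesis .
qed

text \<open>Off the manifold \<^const>\<open>rdist\<close> is the infimum of the empty set, about which nothing is known; it is
  replaced by zero.\<close>

lemma (in connected_riemannian) Metric_space_rdist:
  "Metric_space (pts M) (\<lambda>p q. if p \<in> pts M \<and> q \<in> pts M then rdist M p q else 0)"
proof
  show "(if p \<in> pts M \<and> q \<in> pts M then rdist M p q else 0) =
      (if q \<in> pts M \<and> p \<in> pts M then rdist M q p else 0)" for p q
    using rdist_commute[of p q] by simp
qed (use rdist_nonneg rdist_eq_0_iff rdist_triangle in auto)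

section \<open>The Gromov--Hausdorff estimate\<close>

theorem proposition5p1:
  fixes M1 :: "('a, 'e::euclidean_space) riem"
    and M2 :: "('b, 'e) riem"
    and N :: "('c, 'f::euclidean_space) riem"
    and \<phi>1 :: "'a \<Rightarrow> 'c" and \<phi>2 :: "'b \<Rightarrow> 'c" and B0 :: "'c set"
  assumes "DIM('f) = DIM('e) + 1"
    and "riemannian_manifold M1"
    and "compact_space (mfd_topology M1)" and "connected_space (mfd_topology M1)"
    and "riemannian_manifold M2"
    and "compact_space (mfd_topology M2)" and "connected_space (mfd_topology M2)"
    and "riemannian_manifold N" and "mfd_boundary N = {}"
    and "connected_space (mfd_topology N)"
    and "riem_isometric_embedding M1 N \<phi>1"
    and "riem_isometric_embedding M2 N \<phi>2"
    and "\<phi>1 ` pts M1 \<inter> \<phi>2 ` pts M2 = {}"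
    and "region (mfd_topology N) B0"
    and "\<phi>1 ` pts M1 \<subseteq> mfd_topology N frontier_of B0"
    and "\<phi>2 ` pts M2 \<subseteq> mfd_topology N frontier_of B0"
  shows "gh_dist (pts M1) (rdist M1) (pts M2) (rdist M2)
         \<le> separation M1 N \<phi>1 + separation M2 N \<phi>2
            + hausdorff_dist (pts N) (rdist N) (\<phi>1 ` pts M1) (\<phi>2 ` pts M2)"
proof -
  interpret E1: compact_riem_embedding M1 N \<phi>1
    using assms by unfold_locales
  interpret E2: compact_riem_embedding M2 N \<phi>2
    using assms by unfold_locales
  let ?X = "pts M1" and ?Y = "pts M2" and ?d = "rdist N"
  define C1 where "C1 = embedding_constant M1 N \<phi>1"
  define C2 where "C2 = embedding_constant M2 N \<phi>2"
  define e1 where "e1 = (\<lambda>p q. if p \<in> ?X \<and> q \<in> ?X then rdist M1 p q else 0)"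
  define e2 where "e2 = (\<lambda>p q. if p \<in> ?Y \<and> q \<in> ?Y then rdist M2 p q else 0)"
  define H where "H = {\<rho>. 0 < \<rho> \<and> \<phi>1 ` ?X \<subseteq> tube (pts N) ?d \<rho> (\<phi>2 ` ?Y) \<and>
    \<phi>2 ` ?Y \<subseteq> tube (pts N) ?d \<rho> (\<phi>1 ` ?X)}"
  have C: "0 \<le> C1" "0 \<le> C2" "C1 \<le> separation M1 N \<phi>1" "C2 \<le> separation M2 N \<phi>2"
    unfolding C1_def C2_def
    by (fact E1.embedding_constant_nonneg E2.embedding_constant_nonneg
        E1.embedding_constant_le_separation E2.embedding_constant_le_separation)+
  obtain D1 where D1: "\<And>p q. p \<in> ?X \<Longrightarrow> q \<in> ?X \<Longrightarrow> rdist M1 p q \<le> D1"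
    using E1.M.compact_imp_rdist_bounded[OF E1.compact] by blast
  obtain D2 where D2: "\<And>p q. p \<in> ?Y \<Longrightarrow> q \<in> ?Y \<Longrightarrow> rdist M2 p q \<le> D2"
    using E2.M.compact_imp_rdist_bounded[OF E2.compact] by blast
  have gh: "gh_dist ?X (rdist M1) ?Y (rdist M2) = gh_dist ?X e1 ?Y e2"
    by (rule gh_dist_cong) (simp_all add: e1_def e2_def)
  have bound: "gh_dist ?X e1 ?Y e2 \<le> \<rho> + max C1 C2 / 2" if \<rho>: "\<rho> \<in> H" for \<rho>
  proof (rule gh_dist_le_correspondence)
    \<comment> \<open>Points correspond if their images in \<open>N\<close> are closer than \<open>\<rho>\<close>. By the triangle inequality the distances
      in \<open>N\<close> between images of corresponding pairs differ by less than \<open>2 * \<rho>\<close>, and passing to the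
      intrinsic distances costs at most the larger embedding constant.\<close>
    define R where "R = {(x, y). x \<in> ?X \<and> y \<in> ?Y \<and> ?d (\<phi>1 x) (\<phi>2 y) < \<rho>}"
    show "Metric_space ?X e1" "Metric_space ?Y e2"
      unfolding e1_def e2_def by (rule E1.M.Metric_space_rdist, rule E2.M.Metric_space_rdist)
    show "?X \<noteq> {}" "?Y \<noteq> {}" by (rule E1.M.pts_nonempty, rule E2.M.pts_nonempty)
    show "e1 x x' \<le> D1" if "x \<in> ?X" "x' \<in> ?X" for x x' using D1 that by (simp add: e1_def)
    show "e2 y y' \<le> D2" if "y \<in> ?Y" "y' \<in> ?Y" for y y' using D2 that by (simp add: e2_def)
    show "R \<subseteq> ?X \<times> ?Y" by (auto simp: R_def)
    show "\<exists>y. (x, y) \<in> R" if x: "x \<in> ?X" for x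
    proof -
      have "\<phi>1 x \<in> tube (pts N) ?d \<rho> (\<phi>2 ` ?Y)" using \<rho> x unfolding H_def by blast
      then obtain y where "y \<in> ?Y" "?d (\<phi>2 y) (\<phi>1 x) < \<rho>" unfolding tube_def by blast
      then show ?thesis using x E1.N.rdist_commute[of "\<phi>2 y"] by (auto simp: R_def)
    qed
    show "\<exists>x. (x, y) \<in> R" if y: "y \<in> ?Y" for y
    proof -
      have "\<phi>2 y \<in> tube (pts N) ?d \<rho> (\<phi>1 ` ?X)" using \<rho> y unfolding H_def by blast
      then obtain x where "x \<in> ?X" "?d (\<phi>1 x) (\<phi>2 y) < \<rho>" unfolding tube_def by blast
      then show ?thesis using y by (auto simp: R_def)
    qed
    show "\<bar>e1 x x' - e2 y y'\<bar> \<le> 2 * (\<rho> + max C1 C2 / 2)" if "(x, y) \<in> R" "(x', y') \<in> R" for x y x' y'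
    proof -
      have M: "x \<in> ?X" "x' \<in> ?X" "y \<in> ?Y" "y' \<in> ?Y"
        and near: "?d (\<phi>1 x) (\<phi>2 y) < \<rho>" "?d (\<phi>1 x') (\<phi>2 y') < \<rho>"
        using that by (auto simp: R_def)
      note N = E1.image_pts[OF M(1)] E1.image_pts[OF M(2)] E2.image_pts[OF M(3)] E2.image_pts[OF M(4)]
      have "?d (\<phi>1 x) (\<phi>1 x') \<le> ?d (\<phi>1 x) (\<phi>2 y) + ?d (\<phi>2 y) (\<phi>2 y') + ?d (\<phi>1 x') (\<phi>2 y')"
        using E1.N.rdist_triangle[OF N(1,3,2)] E1.N.rdist_triangle[OF N(3,4,2)]
          E1.N.rdist_commute[of "\<phi>2 y'" "\<phi>1 x'"] by linarith
      moreover have "?d (\<phi>2 y) (\<phi>2 y') \<le> ?d (\<phi>1 x) (\<phi>2 y) + ?d (\<phi>1 x) (\<phi>1 x') + ?d (\<phi>1 x') (\<phi>2 y')"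
        using E1.N.rdist_triangle[OF N(3,1,4)] E1.N.rdist_triangle[OF N(1,2,4)]
          E1.N.rdist_commute[of "\<phi>2 y" "\<phi>1 x"] by linarith
      moreover have "e1 x x' \<le> ?d (\<phi>1 x) (\<phi>1 x') + C1" "?d (\<phi>1 x) (\<phi>1 x') \<le> e1 x x'"
        using E1.rdist_le_embedding_constant[OF M(1,2)] E1.rdist_image_le[OF M(1,2)] M
        by (simp_all add: e1_def C1_def)
      moreover have "e2 y y' \<le> ?d (\<phi>2 y) (\<phi>2 y') + C2" "?d (\<phi>2 y) (\<phi>2 y') \<le> e2 y y'"
        using E2.rdist_le_embedding_constant[OF M(3,4)] E2.rdist_image_le[OF M(3,4)] M
        by (simp_all add: e2_def C2_def)
      ultimately have "\<bar>e1 x x' - e2 y y'\<bar> \<le> 2 * \<rho> + max C1 C2" using near by linarith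
      then show ?thesis by simp
    qed
    show "0 < \<rho> + max C1 C2 / 2" using \<rho> C(1) by (auto simp: H_def)
  qed
  have "H \<noteq> {}"
  proof -
    have "\<exists>\<rho>. 0 < \<rho> \<and> \<phi>1 ` ?X \<subseteq> tube (pts N) ?d \<rho> (\<phi>2 ` ?Y) \<and> \<phi>2 ` ?Y \<subseteq> tube (pts N) ?d \<rho> (\<phi>1 ` ?X)"
    proof (rule tube_radius_exists)
      show "?d p q \<le> D1" if "p \<in> \<phi>1 ` ?X" "q \<in> \<phi>1 ` ?X" for p q
        using that E1.rdist_image_le D1 order_trans by blast
      show "?d p q \<le> D2" if "p \<in> \<phi>2 ` ?Y" "q \<in> \<phi>2 ` ?Y" for p q
        using that E2.rdist_image_le D2 order_trans by blast
    qed (use E1.N.rdist_triangle E1.image_pts E2.image_pts E1.M.pts_nonempty E2.M.pts_nonempty in auto)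
    then show ?thesis unfolding H_def by blast
  qed
  have "gh_dist ?X e1 ?Y e2 - max C1 C2 / 2 \<le> \<rho>" if "\<rho> \<in> H" for \<rho>
    using bound[OF that] by linarith
  then have "gh_dist ?X e1 ?Y e2 - max C1 C2 / 2 \<le> Inf H"
    by (rule cInf_greatest[OF \<open>H \<noteq> {}\<close>])
  moreover have "Inf H = hausdorff_dist (pts N) ?d (\<phi>1 ` ?X) (\<phi>2 ` ?Y)"
    unfolding H_def hausdorff_dist_def ..
  ultimately show ?thesis unfolding gh using C by linarith
qed

end
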